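(* Let $R$ be a complete discrete valuation ring with normalized valuation, whose residue field is finite with $q$ elements, and let $d\geqslant1$. For every positive real number $\ell$, the random variable $V_L$ on $\Omega=M_d(R)$ (with its Haar probability measure) satisfies $$\mathbb{P}\Bigl[\,\bigl|V_L-\log_q d+\tfrac12\bigr|>\ell+\tfrac12\,\Bigr]\leqslant \frac{q}{q-1}\cdot q^{-\ell}\cdot\bigl(2+\ell\log q\bigr),$$ where $\log$ denotes the natural logarithm.
   Context: $R$ is a complete discrete valuation ring with fraction field $K$, valuation $v_R$ normalized so that it takes the value $1$ (uniformizer $\pi$), and finite residue field of cardinality $q$. $\Omega=M_d(R)$ carries its Haar probability measure (entries independent and Haar-distributed in $R$). A matrix $M\in M_d(K)$ admits an LU decomposition if $M=L(M)U(M)$ with $L(M)$ unit lower triangular over $K$ and $U(M)$ upper triangular over $K$ (unique when $M$ is invertible and it exists). For $\omega\in\Omega$ with $L(\omega)$ defined (almost surely), $V_L(\omega)$ is the opposite of the smallest valuation of an entry of $L(\omega)$. *)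

theory Defs
  imports
    "HOL-Probability.Probability"
    "HOL-Computational_Algebra.Polynomial_Factorial"
    "Jordan_Normal_Form.Matrix"
begin

text \<open>
  The type \<open>'r\<close> is the ring R and \<^typ>\<open>'r fract\<close> its fraction field K. The valuation
  is integer-valued and only meaningful on nonzero elements; the value at 0, mathematically
  infinite, is left unconstrained, and 0 is treated separately throughout.
\<close>

locale discrete_valuation_ring =
  fixes v :: "'r::idom fract \<Rightarrow> int"
  assumes v_mult: "x \<noteq> 0 \<Longrightarrow> y \<noteq> 0 \<Longrightarrow> v (x * y) = v x + v y"
    and v_add: "x \<noteq> 0 \<Longrightarrow> y \<noteq> 0 \<Longrightarrow> x + y \<noteq> 0 \<Longrightarrow> min (v x) (v y) \<le> v (x + y)"
    and v_normalized: "\<exists>\<pi>. \<pi> \<noteq> 0 \<and> v \<pi> = 1"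
    and valuation_ring: "range (to_fract :: 'r \<Rightarrow> 'r fract) = {x. x = 0 \<or> 0 \<le> v x}"
begin

text \<open>The base 2 is immaterial: any base greater than 1 gives the same topology and the same
  Cauchy sequences.\<close>

definition val_dist :: "'r \<Rightarrow> 'r \<Rightarrow> real" where
  "val_dist x y = (if x = y then 0 else 2 powr - real_of_int (v (to_fract (x - y))))"

lemma v_one: "v 1 = 0"
  using v_mult[of 1 1] by simp

lemma v_minus: "v (- x) = v x"
proof (cases "x = 0")
  case False
  have "v (- 1) + v (- 1) = 0"
    using v_mult[of "- 1" "- 1"] v_one by simp
  then show ?thesis
    using v_mult[of "- 1" x] False by simp
qed simp

sublocale val: Metric_space "UNIV :: 'r set" val_dist
proof
  show "0 \<le> val_dist x y" for x y
    by (simp add: val_dist_def)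
  show "val_dist x y = val_dist y x" for x y
    using v_minus[of "to_fract (x - y)"] by (simp add: val_dist_def)
  show "(val_dist x y = 0) = (x = y)" for x y
    by (simp add: val_dist_def)
  show "val_dist x z \<le> val_dist x y + val_dist y z" for x y z
  proof (cases "x = y \<or> y = z \<or> x = z")
    case True
    then show ?thesis by (auto simp: val_dist_def)
  next
    case False
    have sum: "to_fract (x - y) + to_fract (y - z) = to_fract (x - z)"
      by (simp add: to_fract_add [symmetric] del: to_fract_diff)
    have "min (v (to_fract (x - y))) (v (to_fract (y - z))) \<le> v (to_fract (x - z))"
      using v_add[of "to_fract (x - y)" "to_fract (y - z)"] False
      unfolding sum to_fract_eq_0_iff by simp
    then have "v (to_fract (x - y)) \<le> v (to_fract (x - z)) \<or>
               v (to_fract (y - z)) \<le> v (to_fract (x - z))"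
      by linarith
    then have "val_dist x z \<le> val_dist x y \<or> val_dist x z \<le> val_dist y z"
      using False by (auto simp: val_dist_def)
    moreover have "0 \<le> val_dist x y" "0 \<le> val_dist y z"
      by (auto simp: val_dist_def)
    ultimately show ?thesis by linarith
  qed
qed

end

locale complete_dvr = discrete_valuation_ring v for v :: "'r::idom fract \<Rightarrow> int" +
  assumes complete: "val.mcomplete"

text \<open>The quotient of a local ring by its maximal ideal, which consists of the non-units.\<close>

definition residue_field :: "'r::idom set set" where
  "residue_field = UNIV // {(x, y). \<not> (x - y) dvd 1}"

definition haar_prob :: "'a::ab_group_add topology \<Rightarrow> 'a measure \<Rightarrow> bool" where
  "haar_prob T \<mu> \<longleftrightarrow> prob_space \<mu> \<and> space \<mu> = topspace T \<and>
     sets \<mu> = sigma_sets (topspace T) {U. openin T U} \<and>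
     (\<forall>a. distr \<mu> \<mu> (\<lambda>x. a + x) = \<mu>)"

text \<open>The space of d by d matrices over R, as families of entries indexed by pairs; the matrix
  of a sample point \<open>\<omega>\<close> is \<^term>\<open>mat d d \<omega>\<close>.\<close>

definition matrix_measure :: "nat \<Rightarrow> 'r measure \<Rightarrow> (nat \<times> nat \<Rightarrow> 'r) measure" where
  "matrix_measure d \<mu> = (\<Pi>\<^sub>M ij \<in> {..<d} \<times> {..<d}. \<mu>)"

definition unit_lower_triangular :: "'a::zero_neq_one mat \<Rightarrow> bool" where
  "unit_lower_triangular A \<longleftrightarrow>
     (\<forall>i < dim_row A. A $$ (i, i) = 1 \<and> (\<forall>j < dim_col A. i < j \<longrightarrow> A $$ (i, j) = 0))"

definition is_LU :: "'k::field mat \<Rightarrow> 'k mat \<Rightarrow> 'k mat \<Rightarrow> bool" where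
  "is_LU M L U \<longleftrightarrow> L \<in> carrier_mat (dim_row M) (dim_row M) \<and> unit_lower_triangular L \<and>
     U \<in> carrier_mat (dim_row M) (dim_row M) \<and> upper_triangular U \<and> M = L * U"

text \<open>\<open>L(M)\<close> is defined for those invertible \<open>M\<close> that admit an LU decomposition, which is then
  unique.\<close>

definition L_defined :: "'k::field mat \<Rightarrow> bool" where
  "L_defined M \<longleftrightarrow> invertible_mat M \<and> (\<exists>L U. is_LU M L U)"

definition L_part :: "'k::field mat \<Rightarrow> 'k mat" where
  "L_part M = (THE L. \<exists>U. is_LU M L U)"

text \<open>Zero entries have infinite valuation and do not affect the minimum.\<close>

definition V_L :: "('r::idom fract \<Rightarrow> int) \<Rightarrow> 'r mat \<Rightarrow> int" where
  "V_L v A = - Min (v ` (elements_mat (L_part (map_mat to_fract A)) - {0}))"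

end

theory Submission
  imports Defs "Jordan_Normal_Form.Determinant"
begin

text \<open>
  Fraction-free Gaussian elimination writes the entries of \<open>L\<close> as quotients of integral polynomials
  in the entries of \<open>M\<close>: after \<open>j\<close> steps, column \<open>j\<close> of \<open>L\<close> is the current column divided by its
  pivot, so \<open>V_L \<ge> n\<close> means that in some column \<open>j\<close> an entry below the pivot, multiplied by \<open>\<pi>^n\<close>,
  divides the pivot. Adding \<open>s\<close> times row \<open>i\<close> to row \<open>j\<close> preserves the Haar measure, leaves
  the events at earlier columns unchanged, and adds \<open>s\<close> times the \<open>i\<close>-th entry to the pivot.
  Averaging over \<open>s\<close> in a system of representatives modulo \<open>\<pi>^n\<close> shows that the event at column
  \<open>j\<close> has probability at most \<open>q^-n\<close>, and, for \<open>j < d - 1\<close>, conditional probability at least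
  \<open>q^-n / 2\<close> given that it fails in all earlier columns. Hence \<open>P(V_L \<ge> n) \<le> d q^-n\<close> and
  \<open>P(V_L < n) \<le> (1 - q^-n / 2)^(d - 1)\<close>; both tails are then at most \<open>q^-l\<close>.
\<close>

section \<open>Fraction-free elimination\<close>

text \<open>Unlike in the Bareiss algorithm proper, the previous pivot is not divided out.\<close>

fun bareiss :: "(nat \<times> nat \<Rightarrow> 'a::comm_ring_1) \<Rightarrow> nat \<Rightarrow> nat \<Rightarrow> nat \<Rightarrow> 'a" where
  "bareiss A 0 i j = A (i, j)"
| "bareiss A (Suc k) i j =
     bareiss A k k k * bareiss A k i j - bareiss A k i k * bareiss A k k j"

lemma bareiss_eq_0: "i < k \<or> j < k \<Longrightarrow> bareiss A k i j = 0"
  by (induction k arbitrary: i j) (auto simp: less_Suc_eq)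

text \<open>Only the leading block is read. With \<open>d = j\<close> this shows that changing the
  entry \<open>(j, j)\<close> leaves all earlier pivots alone.\<close>

lemma bareiss_cong:
  assumes "\<And>a b. a < d \<Longrightarrow> b < d \<Longrightarrow> A (a, b) = B (a, b)" "i < d" "j < d" "k \<le> d"
  shows "bareiss A k i j = bareiss B k i j"
  using assms(2-4) by (induction k arbitrary: i j) (auto simp: assms(1))

lemma to_fract_bareiss: "to_fract (bareiss A k i j) = bareiss (\<lambda>x. to_fract (A x)) k i j"
  by (induction k arbitrary: i j) auto

text \<open>Each step \<open>t < k\<close> multiplies the entry \<open>(k, k)\<close> by the pivot
  and subtracts a product that does not involve it. So the \<open>k\<close>-th pivot is affine in
  this entry, with slope the product of the earlier pivots.\<close>

lemma bareiss_update_diagonal: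
  assumes "i \<ge> k" "j \<ge> k" 
  shows "bareiss (A((k, k) := A (k, k) + s)) k i j =
         bareiss A k i j + (if i = k \<and> j = k then s * (\<Prod>t<k. bareiss A t t t) else 0)"
proof -
  \<comment> \<open>The induction runs over the number \<open>l\<close> of steps with the position
    of the modified entry fixed, since the two coincide in the lemma itself.\<close>
  have "bareiss (A((k, k) := A (k, k) + s)) l i j =
         bareiss A l i j + (if i = k \<and> j = k then s * (\<Prod>t<l. bareiss A t t t) else 0)"
    if "l \<le> k" for i j l
    using that
    by (induction l arbitrary: i j) (auto simp: algebra_simps)
  from this[of k i j] show ?thesis by simp
qed

text \<open>For \<open>i < d\<close>, the bound \<open>b < d\<close> keeps values outside the index
  set untouched, so sample points stay in the product space. A smaller bound restricts the operation
  to the first columns, which serves the induction in \<open>preserving_add_row\<close>.\<close>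

definition add_row :: "nat \<Rightarrow> nat \<Rightarrow> nat \<Rightarrow> 'a::comm_ring_1 \<Rightarrow> (nat \<times> nat \<Rightarrow> 'a) \<Rightarrow> nat \<times> nat \<Rightarrow> 'a" where
  "add_row d i i' s A = (\<lambda>(a, b). if a = i \<and> b < d then A (a, b) + s * A (i', b) else A (a, b))"

text \<open>The first \<open>k\<close> steps use pivot rows with index below \<open>k\<close>, hence
  neither \<open>i\<close> nor \<open>i'\<close>, and each step is linear in the row it transforms.
  The row operation therefore passes through the elimination.\<close>

lemma bareiss_add_row:
  assumes "k \<le> i" "k \<le> i'" "i \<noteq> i'" "b < d" "k \<le> d"
  shows "bareiss (add_row d i i' s A) k a b =
         bareiss A k a b + (if a = i then s * bareiss A k i' b else 0)"
  using assms by (induction k arbitrary: a b) (auto simp: add_row_def algebra_simps)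

lemma sum_from_single:
  fixes f :: "nat \<Rightarrow> 'a::comm_monoid_add"
  assumes "t < d" "\<And>j. j < d \<Longrightarrow> t < j \<Longrightarrow> f j = 0"
  shows "(\<Sum>j = t..<d. f j) = f t"
proof -
  have "(\<Sum>j = t..<d. f j) = (\<Sum>j \<in> {t}. f j)"
    using assms by (intro sum.mono_neutral_right) auto
  then show ?thesis by simp
qed

section \<open>LU decompositions read off from the elimination\<close>

context
  fixes A :: "nat \<times> nat \<Rightarrow> 'k::field" and d :: nat
begin

text \<open>Step \<open>t\<close> removes the rank-one term formed by column \<open>t\<close> of
  \<open>L\<close> and row \<open>t\<close> of \<open>U\<close>, and rescales by the pivot. The
  identity is free of divisions, so it can be applied in \<open>L_defined_iff\<close> before the
  pivots are known to be nonzero.\<close>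

lemma is_LU_bareiss:
  assumes LU: "is_LU (mat d d A) L U" and t: "t \<le> d" and i: "i < d" and k: "k < d"
  shows "bareiss A t i k = (\<Prod>s<t. bareiss A s s s) * (\<Sum>j = t..<d. L $$ (i, j) * U $$ (j, k))"
  using t i k
proof (induction t arbitrary: i k)
  case 0
  have L: "L \<in> carrier_mat d d" and U: "U \<in> carrier_mat d d" and eq: "mat d d A = L * U"
    using LU by (auto simp: is_LU_def)
  have "A (i, k) = (L * U) $$ (i, k)" 
    unfolding eq[symmetric] using 0 by simp
  also have "\<dots> = (\<Sum>j = 0..<d. L $$ (i, j) * U $$ (j, k))"
    using L U 0 by (simp add: scalar_prod_def)
  finally show ?case by simp
next
  case (Suc t)
  let ?c = "\<Prod>s<t. bareiss A s s s"
  have L: "L \<in> carrier_mat d d" "unit_lower_triangular L" and U: "U \<in> carrier_mat d d" "upper_triangular U"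
    using LU by (auto simp: is_LU_def)
  have L1: "L $$ (t, t) = 1" using L Suc.prems by (auto simp: unit_lower_triangular_def)
  have L0: "L $$ (t, j) = 0" if "t < j" "j < d" for j
    using L that by (auto simp: unit_lower_triangular_def)
  have U0: "U $$ (j, t) = 0" if "t < j" "j < d" for j
    using U that by (auto simp: upper_triangular_def)
  have row: "bareiss A t t k = ?c * U $$ (t, k)" if "k < d" for k
    using Suc.IH[of t k] Suc.prems that
      sum_from_single[of t d "\<lambda>j. L $$ (t, j) * U $$ (j, k)"] by (simp add: L0 L1)
  have col: "bareiss A t i t = ?c * (L $$ (i, t) * U $$ (t, t))"
    using Suc.IH[of i t] Suc.prems
      sum_from_single[of t d "\<lambda>j. L $$ (i, j) * U $$ (j, t)"] by (simp add: U0)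
  have split: "(\<Sum>j = t..<d. L $$ (i, j) * U $$ (j, k)) =
     L $$ (i, t) * U $$ (t, k) + (\<Sum>j = Suc t..<d. L $$ (i, j) * U $$ (j, k))"
    using Suc.prems by (intro sum.atLeast_Suc_lessThan) auto
  have ik: "bareiss A t i k =
      ?c * (L $$ (i, t) * U $$ (t, k) + (\<Sum>j = Suc t..<d. L $$ (i, j) * U $$ (j, k)))"
    using Suc.IH[of i k] Suc.prems by (simp only: split)
  have tt: "bareiss A t t t = ?c * U $$ (t, t)" and tk: "bareiss A t t k = ?c * U $$ (t, k)"
    using Suc.prems row by auto
  have "bareiss A (Suc t) i k = ?c * (?c * U $$ (t, t)) * (\<Sum>j = Suc t..<d. L $$ (i, j) * U $$ (j, k))"
    unfolding bareiss.simps(2) ik tt tk col by (simp only: ring_distribs mult_ac) simp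
  then show ?case
    by (simp only: prod.lessThan_Suc tt)
qed

lemma is_LU_bareiss_column:
  assumes LU: "is_LU (mat d d A) L U" and t: "t < d" and i: "i < d"
  shows "bareiss A t i t = (\<Prod>s<t. bareiss A s s s) * (L $$ (i, t) * U $$ (t, t))"
proof -
  have "U $$ (j, t) = 0" if "t < j" "j < d" for j
    using LU that by (auto simp: is_LU_def upper_triangular_def)
  with is_LU_bareiss[OF LU _ i t, of t] t show ?thesis
    using sum_from_single[of t d "\<lambda>j. L $$ (i, j) * U $$ (j, t)"] by simp
qed

lemma is_LU_bareiss_diagonal:
  assumes LU: "is_LU (mat d d A) L U" and t: "t < d"
  shows "bareiss A t t t = (\<Prod>s<t. bareiss A s s s) * U $$ (t, t)"
proof -
  have "L $$ (t, t) = 1"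
    using LU t by (auto simp: is_LU_def unit_lower_triangular_def)
  with is_LU_bareiss_column[OF LU t t] show ?thesis by simp
qed

lemma invertible_mat_iff_det:
  assumes "M \<in> carrier_mat d d"
  shows "invertible_mat M \<longleftrightarrow> det M \<noteq> (0::'k)"
proof
  assume "invertible_mat M"
  then obtain B where "inverts_mat M B" "inverts_mat B M"
    by (auto simp: invertible_mat_def)
  then have MB: "M * B = 1\<^sub>m d" and BM: "B * M = 1\<^sub>m (dim_row B)"
    using assms by (simp_all add: inverts_mat_def)
  have "dim_col B = d" "dim_row B = d"
    using arg_cong[OF MB, of dim_col] arg_cong[OF BM, of dim_col] assms by simp_all
  then have "B \<in> carrier_mat d d" by auto
  with MB have "det M * det B = 1"
    using det_mult[OF assms, of B] by simp
  then show "det M \<noteq> 0" by auto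
next
  assume "det M \<noteq> 0"
  from det_non_zero_imp_unit[OF assms this, of "()"]
  show "invertible_mat M"
    using assms by (auto simp: Units_def ring_mat_def invertible_mat_def inverts_mat_def)
qed

lemma det_LU:
  assumes LU: "is_LU (mat d d A) L U"
  shows "det (mat d d A) = (\<Prod>i<d. U $$ (i, i))"
proof -
  have L: "L \<in> carrier_mat d d" "unit_lower_triangular L" and U: "U \<in> carrier_mat d d" "upper_triangular U"
    and eq: "mat d d A = L * U"
    using LU by (auto simp: is_LU_def)
  have "det L = prod_list (diag_mat L)"
    using L by (intro det_lower_triangular[of d]) (auto simp: unit_lower_triangular_def)
  also have "\<dots> = 1"
    using L by (simp add: prod_list_diag_prod unit_lower_triangular_def)
  finally show ?thesis
    unfolding eq det_mult[OF L(1) U(1)] det_upper_triangular[OF U(2,1)]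
    using U by (simp add: prod_list_diag_prod lessThan_atLeast0)
qed

lemma is_LU_of_bareiss:
  assumes nz: "\<And>j. j < d \<Longrightarrow> bareiss A j j j \<noteq> 0"
  shows "is_LU (mat d d A) (mat d d (\<lambda>(i, j). bareiss A j i j / bareiss A j j j))
           (mat d d (\<lambda>(j, k). bareiss A j j k / (\<Prod>s<j. bareiss A s s s)))"
    (is "is_LU _ ?L ?U")
proof -
  let ?c = "\<lambda>t. \<Prod>s<t. bareiss A s s s"
  have c: "?c t \<noteq> 0" if "t \<le> d" for t
    using nz that by auto
  \<comment> \<open>Invariant of the elimination: the rank-one terms split off so far plus the
    rescaled remainder. After \<open>d\<close> steps the remainder vanishes by
    \<open>bareiss_eq_0\<close>.\<close>
  have *: "A (i, k) = (\<Sum>j<t. bareiss A j i j / bareiss A j j j * (bareiss A j j k / ?c j))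
      + bareiss A t i k / ?c t" if "t \<le> d" for i k t
    using that
  proof (induction t)
    case (Suc t)
    have "bareiss A t i k / ?c t = bareiss A t i t / bareiss A t t t * (bareiss A t t k / ?c t)
       + bareiss A (Suc t) i k / ?c (Suc t)"
      using nz[of t] c[of t] Suc.prems by (simp add: field_simps)
    with Suc show ?case by simp
  qed simp
  have "A (i, k) = (\<Sum>j<d. bareiss A j i j / bareiss A j j j * (bareiss A j j k / ?c j))"
    if "i < d" for i k
    using *[of d i k] that by (simp add: bareiss_eq_0)
  then have "mat d d A = ?L * ?U"
    by (intro eq_matI) (auto simp: scalar_prod_def lessThan_atLeast0)
  then show ?thesis
    using nz by (auto simp: is_LU_def unit_lower_triangular_def upper_triangular_def bareiss_eq_0)
qed

text \<open>The pivot \<open>j\<close> is \<open>U $$ (j, j)\<close> times all earlier pivots, and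
  the determinant is the product of the diagonal of \<open>U\<close>. Strong induction on
  \<open>j\<close> then turns invertibility into nonvanishing of every pivot.\<close>

lemma L_defined_iff: "L_defined (mat d d A) \<longleftrightarrow> (\<forall>j<d. bareiss A j j j \<noteq> 0)"
proof
  assume "L_defined (mat d d A)"
  then obtain L U where inv: "invertible_mat (mat d d A)" and LU: "is_LU (mat d d A) L U"
    by (auto simp: L_defined_def)
  have U: "U $$ (i, i) \<noteq> 0" if "i < d" for i
    using inv det_LU[OF LU] that invertible_mat_iff_det[of "mat d d A"] by auto
  have "j < d \<longrightarrow> bareiss A j j j \<noteq> 0" for j
  proof (induction j rule: less_induct)
    case (less j)
    show ?case
      using less U[of j] by (cases "j < d") (auto simp: is_LU_bareiss_diagonal[OF LU, of j])
  qed
  then show "\<forall>j<d. bareiss A j j j \<noteq> 0" by auto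
next
  assume nz: "\<forall>j<d. bareiss A j j j \<noteq> 0"
  have LU: "is_LU (mat d d A) (mat d d (\<lambda>(i, j). bareiss A j i j / bareiss A j j j))
           (mat d d (\<lambda>(j, k). bareiss A j j k / (\<Prod>s<j. bareiss A s s s)))"
    by (rule is_LU_of_bareiss) (use nz in auto)
  have "det (mat d d A) \<noteq> 0"
    unfolding det_LU[OF LU] using nz by auto
  then show "L_defined (mat d d A)"
    unfolding L_defined_def using LU invertible_mat_iff_det[of "mat d d A"] mat_carrier by blast
qed

text \<open>Uniqueness: a column entry and its pivot share the factor formed by the earlier pivots
  and the diagonal entry of \<open>U\<close>. This factor is nonzero and cancels in the quotient,
  which forces every entry of \<open>L\<close>.\<close>

lemma L_part_eq:
  assumes nz: "\<And>j. j < d \<Longrightarrow> bareiss A j j j \<noteq> 0"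
  shows "L_part (mat d d A) = mat d d (\<lambda>(i, j). bareiss A j i j / bareiss A j j j)"
  unfolding L_part_def
proof (rule the_equality)
  show "\<exists>U. is_LU (mat d d A) (mat d d (\<lambda>(i, j). bareiss A j i j / bareiss A j j j)) U"
    using is_LU_of_bareiss nz by blast
next
  fix L assume "\<exists>U. is_LU (mat d d A) L U"
  then obtain U where LU: "is_LU (mat d d A) L U" by blast
  have "L $$ (i, j) = bareiss A j i j / bareiss A j j j" if "i < d" "j < d" for i j
    using nz[OF that(2)] is_LU_bareiss_column[OF LU that(2,1)] is_LU_bareiss_diagonal[OF LU that(2)]
    by (auto simp: field_simps)
  then show "L = mat d d (\<lambda>(i, j). bareiss A j i j / bareiss A j j j)"
    using LU by (intro eq_matI) (auto simp: is_LU_def)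
qed

end

section \<open>Discrete valuation rings\<close>

lemma dvd_diff_swap: "c dvd x - y \<Longrightarrow> c dvd y - (x :: 'a::comm_ring_1)"
  by (metis dvd_minus_iff minus_diff_eq)

context discrete_valuation_ring
begin

lemma v_nonneg: "x \<noteq> 0 \<Longrightarrow> 0 \<le> v (to_fract x)"
  using valuation_ring by (metis (mono_tags, lifting) mem_Collect_eq rangeI to_fract_eq_0_iff)

lemma v_div: "x \<noteq> 0 \<Longrightarrow> y \<noteq> 0 \<Longrightarrow> v (x / y) = v x - v y"
  using v_mult[of "x / y" y] by simp

text \<open>Lets divisibility in R replace comparison of valuations from here on, so that 0 needs no
  infinite valuation. The converse direction is the description of R as the elements of nonnegative
  valuation.\<close>

lemma dvd_iff_v: "a dvd b \<longleftrightarrow> b = 0 \<or> (a \<noteq> 0 \<and> v (to_fract a) \<le> v (to_fract b))"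
proof (cases "a = 0 \<or> b = 0")
  case False
  show ?thesis
  proof
    assume "a dvd b"
    then obtain c where c: "b = a * c" by auto
    then have "v (to_fract b) = v (to_fract a) + v (to_fract c)" "c \<noteq> 0"
      using False v_mult[of "to_fract a" "to_fract c"] by auto
    then show "b = 0 \<or> (a \<noteq> 0 \<and> v (to_fract a) \<le> v (to_fract b))"
      using False v_nonneg[of c] by auto
  next
    assume "b = 0 \<or> (a \<noteq> 0 \<and> v (to_fract a) \<le> v (to_fract b))"
    then have "0 \<le> v (to_fract b / to_fract a)"
      using False by (simp add: v_div)
    then have "to_fract b / to_fract a \<in> range to_fract"
      by (simp add: valuation_ring)
    then obtain c where "to_fract b / to_fract a = to_fract c" by auto
    then have "to_fract b = to_fract (a * c)"
      using False by (simp add: field_simps)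
    then show "a dvd b"
      unfolding to_fract_eq_iff by simp
  qed
qed auto

lemma dvd_total: "a dvd b \<or> b dvd (a :: 'r)"
  by (auto simp: dvd_iff_v)

text \<open>The ultrametric inequality in divisibility form: one of \<open>a\<close> and
  \<open>b\<close> divides the other, hence divides \<open>a - s * b\<close>.\<close>

lemma dvd_add_mult_cases:
  fixes a b x s :: 'r
  assumes "c * (a - s * b) dvd x"
  shows "c * a dvd x \<or> c * b dvd x"
proof (cases "a dvd b")
  case True
  then have "a dvd a - s * b" by auto
  then have "c * a dvd c * (a - s * b)" by (rule mult_dvd_mono[OF dvd_refl])
  then show ?thesis using assms dvd_trans by blast
next
  case False
  then have "b dvd a - s * b" using dvd_total[of a b] by auto
  then have "c * b dvd c * (a - s * b)" by (rule mult_dvd_mono[OF dvd_refl])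
  then show ?thesis using assms dvd_trans by blast
qed

lemma exists_dvd_least:
  fixes b :: "'i \<Rightarrow> 'r" and I :: "'i set"
  assumes "finite I" "I \<noteq> {}"
  shows "\<exists>i\<in>I. \<forall>i'\<in>I. b i dvd b i'"
  using assms
proof (induction rule: finite_ne_induct)
  case (insert x F)
  then obtain i where i: "i \<in> F" "\<And>i'. i' \<in> F \<Longrightarrow> b i dvd b i'" by blast
  show ?case
  proof (cases "b x dvd b i")
    case True
    then have "b x dvd b i'" if "i' \<in> insert x F" for i'
      using that i(2)[of i'] dvd_trans[of "b x" "b i" "b i'"] by auto
    then show ?thesis by blast
  next
    case False
    then show ?thesis using i dvd_total[of "b i" "b x"] by (intro bexI[of _ i]) auto
  qed
qed simp

end

section \<open>Powers of a uniformizer, topology and residue systems\<close>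

locale uniformized_dvr = discrete_valuation_ring v for v :: "'r::idom fract \<Rightarrow> int" +
  fixes p :: 'r
  assumes p_nonzero [simp]: "p \<noteq> 0" and v_p: "v (to_fract p) = 1"
begin

lemma v_power_p: "v (to_fract (p ^ n)) = int n"
proof (induction n)
  case (Suc n)
  have "v (to_fract p * to_fract (p ^ n)) = v (to_fract p) + v (to_fract (p ^ n))"
    by (rule v_mult) auto
  with Suc show ?case by (simp add: v_p)
qed (simp add: v_one)

lemma power_dvd_iff: "p ^ n dvd x \<longleftrightarrow> x = 0 \<or> int n \<le> v (to_fract x)"
  by (simp add: dvd_iff_v v_power_p del: to_fract_mult)

lemma not_unit_iff: "\<not> x dvd 1 \<longleftrightarrow> p dvd x"
  using v_nonneg[of x] by (auto simp: dvd_iff_v v_one v_p)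

text \<open>Turns divisibility between two varying elements into countably many conditions with
  fixed divisors, which is what makes \<open>dvd\<close> measurable in
  \<open>pred_dvd_haar\<close>.\<close>

lemma dvd_iff_powers: "x dvd y \<longleftrightarrow> (\<forall>k. p ^ k dvd x \<longrightarrow> p ^ k dvd y)"
proof
  assume *: "\<forall>k. p ^ k dvd x \<longrightarrow> p ^ k dvd y"
  consider "y = 0" | "x = 0" "y \<noteq> 0" | "x \<noteq> 0" "y \<noteq> 0" by blast
  then show "x dvd y"
  proof cases
    case 2
    \<comment> \<open>Every power divides 0, so the exponent one above the valuation of
      \<open>y\<close> gives a contradiction.\<close>
    then have "p ^ nat (v (to_fract y) + 1) dvd y" using * by auto
    with 2 v_nonneg[of y] show ?thesis by (simp add: power_dvd_iff)
  next
    case 3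
    have "p ^ nat (v (to_fract x)) dvd x" using 3 v_nonneg[of x] by (simp add: power_dvd_iff)
    then have "p ^ nat (v (to_fract x)) dvd y" using * by blast
    then have "int (nat (v (to_fract x))) \<le> v (to_fract y)" using 3 by (simp only: power_dvd_iff) simp
    with 3 v_nonneg[of x] show ?thesis by (simp add: dvd_iff_v)
  qed auto
qed (auto intro: dvd_trans)

text \<open>The residue classes modulo powers of \<open>p\<close> form a basis of neighbourhoods:
  distance at most \<open>2 powr - n\<close> means congruence modulo \<open>p ^ n\<close>.\<close>

lemma openin_mtopology_iff:
  "openin val.mtopology U \<longleftrightarrow> (\<forall>x\<in>U. \<exists>n. \<forall>y. p ^ n dvd y - x \<longrightarrow> y \<in> U)"
proof
  assume U: "openin val.mtopology U"
  show "\<forall>x\<in>U. \<exists>n. \<forall>y. p ^ n dvd y - x \<longrightarrow> y \<in> U"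
  proof
    fix x assume "x \<in> U"
    with U obtain r where r: "r > 0" "val.mball x r \<subseteq> U"
      by (auto simp: val.openin_mtopology)
    obtain n where n: "(1 / 2) ^ n < r"
      using real_arch_pow_inv[OF r(1), of "1/2"] by auto
    have "y \<in> U" if "p ^ n dvd y - x" for y
    proof (cases "x = y")
      case False
      then have *: "int n \<le> v (to_fract (x - y))"
        using that v_minus[of "to_fract (y - x)"] by (auto simp: power_dvd_iff)
      have "val_dist x y = 2 powr - real_of_int (v (to_fract (x - y)))"
        using False by (simp add: val_dist_def)
      also have "\<dots> \<le> 2 powr - real n"
        using * by (intro powr_mono) linarith+
      also have "\<dots> = (1 / 2) ^ n"
        by (simp add: powr_minus powr_realpow power_one_over field_simps)
      finally show ?thesis using n r by auto
    qed (use \<open>x \<in> U\<close> in simp)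
    then show "\<exists>n. \<forall>y. p ^ n dvd y - x \<longrightarrow> y \<in> U" by blast
  qed
next
  assume *: "\<forall>x\<in>U. \<exists>n. \<forall>y. p ^ n dvd y - x \<longrightarrow> y \<in> U"
  show "openin val.mtopology U"
    unfolding val.openin_mtopology
  proof (intro conjI allI impI)
    fix x assume "x \<in> U"
    with * obtain n where n: "\<And>y. p ^ n dvd y - x \<Longrightarrow> y \<in> U" by blast
    have "p ^ n dvd y - x" if "val_dist x y < 2 powr - real n" for y
      using that v_minus[of "to_fract (y - x)"]
      by (auto simp: val_dist_def power_dvd_iff split: if_splits)
    then show "\<exists>r>0. val.mball x r \<subseteq> U"
      using n by (intro exI[of _ "2 powr - real n"]) auto
  qed auto
qed

lemma residue_field_eq: "(residue_field :: 'r set set) = UNIV // {(x, y). p dvd x - y}"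
  by (simp add: residue_field_def not_unit_iff)

lemma equiv_mod_p: "equiv UNIV {(x, y). p dvd x - y}"
proof (rule equivI)
  show "sym {(x, y). p dvd x - y}" using dvd_diff_swap by (auto simp: sym_def)
  have "p dvd x - z" if "p dvd x - y" "p dvd y - z" for x y z
    using dvd_add[OF that] by simp
  then show "trans {(x, y). p dvd x - y}"
    unfolding trans_def by blast
qed (auto simp: refl_on_def)

lemma residue_representatives:
  obtains S :: "'r set" where "bij_betw (\<lambda>x. {(x, y). p dvd x - y} `` {x}) S residue_field"
    "\<And>x. \<exists>!s. s \<in> S \<and> p dvd x - s"
proof -
  let ?E = "{(x, y). p dvd x - y}"
  define r where "r = (\<lambda>X. SOME x. x \<in> (X :: 'r set))"
  have r: "?E `` {r X} = X" "r X \<in> X" if "X \<in> residue_field" for X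
  proof -
    from that obtain x where X: "X = ?E `` {x}" by (auto simp: residue_field_eq quotient_def)
    then have "x \<in> X" by auto
    then show "r X \<in> X" unfolding r_def by (rule someI)
    then show "?E `` {r X} = X"
      using X equiv_class_eq[OF equiv_mod_p, of x "r X"] by auto
  qed
  have in_res: "?E `` {x} \<in> residue_field" for x by (auto simp: residue_field_eq quotient_def)
  show thesis
  proof (rule that[of "r ` residue_field"])
    show "bij_betw (\<lambda>x. ?E `` {x}) (r ` residue_field) residue_field"
      by (rule bij_betw_byWitness[where f' = r]) (use r in auto)
    fix x :: 'r
    show "\<exists>!s. s \<in> r ` residue_field \<and> p dvd x - s"
    proof (rule ex1I[of _ "r (?E `` {x})"])
      show "r (?E `` {x}) \<in> r ` residue_field \<and> p dvd x - r (?E `` {x})"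
        using in_res[of x] r(2)[OF in_res[of x]] by auto
    next
      fix s assume s: "s \<in> r ` residue_field \<and> p dvd x - s"
      then obtain X where X: "X \<in> residue_field" "s = r X" by auto
      then have "X = ?E `` {s}" using r by auto
      also have "\<dots> = ?E `` {x}"
        using s by (intro equiv_class_eq[OF equiv_mod_p]) (simp add: dvd_diff_swap)
      finally show "s = r (?E `` {x})" using X by simp
    qed
  qed
qed

end

locale finite_residue_dvr = uniformized_dvr v p
  for v :: "'r::idom fract \<Rightarrow> int" and p :: 'r +
  fixes q :: nat
  assumes finite_residue_field: "finite (residue_field :: 'r set set)"
    and card_residue_field: "card (residue_field :: 'r set set) = q"
begin

text \<open>Expansion in digits: a class modulo \<open>p ^ Suc n\<close> is a class \<open>s\<close>
  modulo \<open>p ^ n\<close> together with one further digit \<open>t\<close> modulo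
  \<open>p\<close>, which multiplies the count by \<open>q\<close>.\<close>

lemma representatives_exist:
  "\<exists>S :: 'r set. finite S \<and> card S = q ^ n \<and> (\<forall>x. \<exists>!s. s \<in> S \<and> p ^ n dvd x - s)"
proof (induction n)
  case 0
  show ?case by (intro exI[of _ "{0}"]) auto
next
  case (Suc n)
  then obtain S :: "'r set" where S: "finite S" "card S = q ^ n" "\<And>x. \<exists>!s. s \<in> S \<and> p ^ n dvd x - s"
    by blast
  obtain T :: "'r set" where T: "bij_betw (\<lambda>x. {(x, y). p dvd x - y} `` {x}) T residue_field"
    "\<And>x. \<exists>!t. t \<in> T \<and> p dvd x - t"
    using residue_representatives by blast
  have T': "finite T" "card T = q"
    using T(1) finite_residue_field card_residue_field bij_betw_finite bij_betw_same_card by fastforce+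
  let ?f = "\<lambda>(s, t). s + p ^ n * t"
  \<comment> \<open>Reduction modulo \<open>p ^ n\<close> identifies \<open>s\<close>, then division
    by \<open>p ^ n\<close> identifies \<open>t\<close>. This gives both injectivity of
    \<open>?f\<close> and uniqueness of the representative.\<close>
  have key: "s = s' \<and> t = t'"
    if "s \<in> S" "s' \<in> S" "t \<in> T" "t' \<in> T" "p ^ Suc n dvd x - (s + p ^ n * t)" "p ^ Suc n dvd x - (s' + p ^ n * t')"
    for s s' t t' x
  proof -
    have *: "p ^ n dvd x - s" if "p ^ Suc n dvd x - (s + p ^ n * t)" for s t
    proof -
      have "p ^ n dvd x - (s + p ^ n * t)" using that by (rule power_le_dvd) simp
      then have "p ^ n dvd (x - (s + p ^ n * t)) + p ^ n * t" by (rule dvd_add) simp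
      then show ?thesis by simp
    qed
    have s: "s = s'" using S(3)[of x] *[OF that(5)] *[OF that(6)] that(1,2) by blast
    have "p ^ Suc n dvd (x - (s' + p ^ n * t')) - (x - (s + p ^ n * t))"
      using that(5,6) by (rule dvd_diff[rotated])
    also have "\<dots> = p ^ n * (t - t')" using s by (simp add: algebra_simps)
    finally have "p dvd t - t'" by (simp add: mult.commute[of p])
    then have "t = t'" using T(2)[of t] that(3,4) by auto
    with s show ?thesis by simp
  qed
  have inj: "inj_on ?f (S \<times> T)"
  proof (rule inj_onI)
    fix a b assume "a \<in> S \<times> T" "b \<in> S \<times> T" "?f a = ?f b"
    then show "a = b" using key[of "fst a" "fst b" "snd a" "snd b" "?f a"]
      by (auto simp: split_beta)
  qed
  show ?case
  proof (intro exI[of _ "?f ` (S \<times> T)"] conjI allI)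
    show "card (?f ` (S \<times> T)) = q ^ Suc n"
      using inj S T' by (simp add: card_image card_cartesian_product)
    fix x :: 'r
    obtain s where s: "s \<in> S" "p ^ n dvd x - s" using S(3)[of x] by blast
    then obtain y where y: "x - s = p ^ n * y" by auto
    obtain t where t: "t \<in> T" "p dvd y - t" using T(2)[of y] by blast
    have "x - (s + p ^ n * t) = p ^ n * (y - t)" using y by (simp add: algebra_simps)
    also have "p ^ Suc n dvd \<dots>" using t(2) by (simp add: mult.commute[of p])
    finally have "p ^ Suc n dvd x - (s + p ^ n * t)" .
    note st = this
    show "\<exists>!z. z \<in> ?f ` (S \<times> T) \<and> p ^ Suc n dvd x - z"
    proof (rule ex1I[of _ "s + p ^ n * t"])
      show "s + p ^ n * t \<in> ?f ` (S \<times> T) \<and> p ^ Suc n dvd x - (s + p ^ n * t)"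
        using st s t by (auto simp del: power_Suc)
    next
      fix z assume "z \<in> ?f ` (S \<times> T) \<and> p ^ Suc n dvd x - z"
      then obtain s' t' where z: "z = s' + p ^ n * t'" "s' \<in> S" "t' \<in> T"
        "p ^ Suc n dvd x - (s' + p ^ n * t')" by (auto simp del: power_Suc)
      from key[OF s(1) z(2) t(1) z(3) st z(4)] z(1) show "z = s + p ^ n * t" by simp
    qed
  qed (use S T' in auto)
qed

definition reps :: "nat \<Rightarrow> 'r set" where
  "reps n = (SOME S. finite S \<and> card S = q ^ n \<and> (\<forall>x. \<exists>!s. s \<in> S \<and> p ^ n dvd x - s))"

lemma reps: "finite (reps n)" "card (reps n) = q ^ n" "\<exists>!s. s \<in> reps n \<and> p ^ n dvd x - s"
  using someI_ex[OF representatives_exist[of n]] unfolding reps_def by blast+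

lemma q_ge_2: "q \<ge> 2"
proof -
  obtain s where s: "s \<in> reps 1" "p dvd 0 - s" using reps(3)[of 1 0] by auto
  obtain t where t: "t \<in> reps 1" "p dvd 1 - t" using reps(3)[of 1 1] by auto
  have "s \<noteq> t"
  proof
    assume "s = t"
    then have "p dvd (1 - t) - (0 - s)" using s t dvd_diff by blast
    with \<open>s = t\<close> not_unit_iff[of 1] show False by simp
  qed
  then have "card {s, t} \<le> card (reps 1)"
    using s t by (intro card_mono reps) auto
  with \<open>s \<noteq> t\<close> show ?thesis by (simp add: reps(2))
qed

end

section \<open>Haar measure\<close>

definition preserving :: "'b measure \<Rightarrow> ('b \<Rightarrow> 'b) \<Rightarrow> bool" where
  "preserving M T \<longleftrightarrow> T \<in> measurable M M \<and> distr M M T = M"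

lemma preserving_comp:
  assumes "preserving M S" "preserving M T"
  shows "preserving M (\<lambda>\<xi>. S (T \<xi>))"
proof -
  have S: "S \<in> measurable M M" "distr M M S = M" and T: "T \<in> measurable M M" "distr M M T = M"
    using assms by (simp_all add: preserving_def)
  have "distr M M (\<lambda>\<xi>. S (T \<xi>)) = M"
    using distr_distr[OF S(1) T(1)] by (simp add: S T comp_def)
  with measurable_compose[OF T(1) S(1)] show ?thesis by (simp add: preserving_def)
qed

lemma measure_preserving_vimage:
  assumes "preserving M T" "B \<in> sets M"
  shows "measure M (T -` B \<inter> space M) = measure M B" "T -` B \<inter> space M \<in> sets M"
  using assms measure_distr[of T M M B] measurable_sets[of T M M B] by (auto simp: preserving_def)

lemma preserving_in_space: "preserving M T \<Longrightarrow> \<xi> \<in> space M \<Longrightarrow> T \<xi> \<in> space M"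
  by (auto simp: preserving_def measurable_space)

locale haar_dvr = finite_residue_dvr v p q
  for v :: "'r::idom fract \<Rightarrow> int" and p :: 'r and q :: nat +
  fixes \<mu> :: "'r measure"
  assumes haar: "haar_prob val.mtopology \<mu>"
begin

lemma space_haar [simp]: "space \<mu> = UNIV"
  using haar by (simp add: haar_prob_def)

lemma sets_haar: "sets \<mu> = sigma_sets UNIV {U. openin val.mtopology U}"
  using haar by (simp add: haar_prob_def)

lemma prob_space_haar: "prob_space \<mu>"
  using haar by (simp add: haar_prob_def)

lemma distr_add_haar: "distr \<mu> \<mu> (\<lambda>x. a + x) = \<mu>"
  using haar by (simp add: haar_prob_def)

text \<open>Since there are finitely many classes modulo each \<open>p ^ n\<close>, every open set
  is a countable union of residue classes, so these suffice to test measurability.\<close>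

lemma measurable_haarI:
  assumes "\<And>n c. {\<omega> \<in> space M. p ^ n dvd f \<omega> - c} \<in> sets M"
  shows "f \<in> measurable M \<mu>"
proof (rule measurable_sigma_sets[OF sets_haar])
  fix U assume "U \<in> {U. openin val.mtopology U}"
  then have U: "\<And>x. x \<in> U \<Longrightarrow> \<exists>n. \<forall>y. p ^ n dvd y - x \<longrightarrow> y \<in> U"
    by (simp add: openin_mtopology_iff)
  \<comment> \<open>Representatives of the classes modulo \<open>p ^ n\<close> that lie entirely
    inside \<open>U\<close>.\<close>
  let ?R = "\<lambda>n. {s \<in> reps n. \<forall>y. p ^ n dvd y - s \<longrightarrow> y \<in> U}"
  have "f -` U \<inter> space M = (\<Union>n. \<Union>s\<in>?R n. {\<omega> \<in> space M. p ^ n dvd f \<omega> - s})"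
  proof (intro equalityI subsetI)
    fix \<omega> assume \<omega>: "\<omega> \<in> f -` U \<inter> space M"
    then obtain n where n: "\<And>y. p ^ n dvd y - f \<omega> \<Longrightarrow> y \<in> U" using U by blast
    obtain s where s: "s \<in> reps n" "p ^ n dvd f \<omega> - s" using reps(3)[of n "f \<omega>"] by blast
    have "y \<in> U" if "p ^ n dvd y - s" for y
      using n[of y] dvd_diff[OF that s(2)] by simp
    with s \<omega> show "\<omega> \<in> (\<Union>n. \<Union>s\<in>?R n. {\<omega> \<in> space M. p ^ n dvd f \<omega> - s})" by blast
  qed auto
  also have "\<dots> \<in> sets M"
    using assms by (intro sets.countable_UN'' sets.finite_UN) (auto simp: reps)
  finally show "f -` U \<inter> space M \<in> sets M" .
qed auto

lemma cylinder_in_sets: "{x. p ^ n dvd x - c} \<in> sets \<mu>"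
proof -
  have "openin val.mtopology {x. p ^ n dvd x - c}"
    unfolding openin_mtopology_iff
  proof (intro ballI exI[of _ n] allI impI)
    fix x y assume "x \<in> {x. p ^ n dvd x - c}" "p ^ n dvd y - x"
    then have "p ^ n dvd (y - x) + (x - c)" by (intro dvd_add) auto
    then show "y \<in> {x. p ^ n dvd x - c}" by simp
  qed
  then show ?thesis unfolding sets_haar by (intro sigma_sets.Basic) simp
qed

lemma pred_power_dvd_diff:
  assumes "f \<in> measurable M \<mu>"
  shows "{\<omega> \<in> space M. p ^ n dvd f \<omega> - c} \<in> sets M"
  using measurable_sets[OF assms cylinder_in_sets[of n c]]
  by (simp add: vimage_def Int_def conj_commute)

lemma power_dvd_mult_diff_cong:
  assumes "p ^ n dvd x - s" "p ^ n dvd y - t"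
  shows "p ^ n dvd x * y - c \<longleftrightarrow> p ^ n dvd s * t - c"
proof -
  have "x * y - s * t = (x - s) * y + s * (y - t)" by (simp add: algebra_simps)
  also have "p ^ n dvd \<dots>" using assms by (intro dvd_add) auto
  finally have *: "p ^ n dvd x * y - s * t" .
  have "x * y - c = (x * y - s * t) + (s * t - c)" by simp
  then show ?thesis using dvd_add_right_iff[OF *] by metis
qed

text \<open>Modulo \<open>p ^ n\<close> a product depends only on the residues of its factors, so
  the preimage of a class is a finite union over pairs of representatives.\<close>

lemma measurable_haar_mult [measurable (raw)]:
  assumes "f \<in> measurable M \<mu>" "g \<in> measurable M \<mu>"
  shows "(\<lambda>\<omega>. f \<omega> * g \<omega>) \<in> measurable M \<mu>"
proof (rule measurable_haarI)
  fix n c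
  have "{\<omega> \<in> space M. p ^ n dvd f \<omega> * g \<omega> - c} =
    (\<Union>s\<in>reps n. \<Union>t\<in>{t \<in> reps n. p ^ n dvd s * t - c}.
       {\<omega> \<in> space M. p ^ n dvd f \<omega> - s} \<inter> {\<omega> \<in> space M. p ^ n dvd g \<omega> - t})"
  proof (intro equalityI subsetI)
    fix \<omega> assume *: "\<omega> \<in> {\<omega> \<in> space M. p ^ n dvd f \<omega> * g \<omega> - c}"
    obtain s where "s \<in> reps n" "p ^ n dvd f \<omega> - s" using reps(3)[of n "f \<omega>"] by blast
    moreover obtain t where "t \<in> reps n" "p ^ n dvd g \<omega> - t" using reps(3)[of n "g \<omega>"] by blast
    ultimately show "\<omega> \<in> (\<Union>s\<in>reps n. \<Union>t\<in>{t \<in> reps n. p ^ n dvd s * t - c}.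
       {\<omega> \<in> space M. p ^ n dvd f \<omega> - s} \<inter> {\<omega> \<in> space M. p ^ n dvd g \<omega> - t})"
      using * power_dvd_mult_diff_cong[of n "f \<omega>" s "g \<omega>" t c] by auto
  qed (auto simp: power_dvd_mult_diff_cong)
  also have "\<dots> \<in> sets M"
    using assms by (intro sets.finite_UN sets.Int pred_power_dvd_diff) (auto simp: reps)
  finally show "{\<omega> \<in> space M. p ^ n dvd f \<omega> * g \<omega> - c} \<in> sets M" .
qed

lemma measurable_haar_add [measurable (raw)]:
  assumes "f \<in> measurable M \<mu>" "g \<in> measurable M \<mu>"
  shows "(\<lambda>\<omega>. f \<omega> + g \<omega>) \<in> measurable M \<mu>"
proof (rule measurable_haarI)
  fix n c
  have iff: "p ^ n dvd x + y - c \<longleftrightarrow> p ^ n dvd y - (c - s)" if "p ^ n dvd x - s" for x y s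
  proof -
    have "x + y - c = (x - s) + (y - (c - s))" by simp
    then show ?thesis using dvd_add_right_iff[OF that] by metis
  qed
  have "{\<omega> \<in> space M. p ^ n dvd f \<omega> + g \<omega> - c} =
    (\<Union>s\<in>reps n. {\<omega> \<in> space M. p ^ n dvd f \<omega> - s} \<inter> {\<omega> \<in> space M. p ^ n dvd g \<omega> - (c - s)})"
  proof (intro equalityI subsetI)
    fix \<omega> assume *: "\<omega> \<in> {\<omega> \<in> space M. p ^ n dvd f \<omega> + g \<omega> - c}"
    obtain s where "s \<in> reps n" "p ^ n dvd f \<omega> - s" using reps(3)[of n "f \<omega>"] by blast
    then show "\<omega> \<in> (\<Union>s\<in>reps n. {\<omega> \<in> space M. p ^ n dvd f \<omega> - s} \<inter>
        {\<omega> \<in> space M. p ^ n dvd g \<omega> - (c - s)})"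
      using * iff[of "f \<omega>" s "g \<omega>"] by auto
  qed (use iff in blast)
  also have "\<dots> \<in> sets M"
    using assms by (intro sets.finite_UN sets.Int pred_power_dvd_diff) (auto simp: reps)
  finally show "{\<omega> \<in> space M. p ^ n dvd f \<omega> + g \<omega> - c} \<in> sets M" .
qed

lemma measurable_haar_diff [measurable (raw)]:
  assumes "f \<in> measurable M \<mu>" "g \<in> measurable M \<mu>"
  shows "(\<lambda>\<omega>. f \<omega> - g \<omega>) \<in> measurable M \<mu>"
proof -
  have "(\<lambda>\<omega>. f \<omega> + (- 1) * g \<omega>) \<in> measurable M \<mu>"
    using assms by measurable
  then show ?thesis by simp
qed

lemma pred_dvd_haar [measurable (raw)]:
  assumes [measurable]: "f \<in> measurable M \<mu>" "g \<in> measurable M \<mu>"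
  shows "Measurable.pred M (\<lambda>\<omega>. f \<omega> dvd g \<omega>)"
proof -
  have [measurable]: "Measurable.pred M (\<lambda>\<omega>. p ^ n dvd h \<omega>)" if "h \<in> measurable M \<mu>" for n h
    using pred_power_dvd_diff[OF that, of n 0] by (simp add: pred_def)
  have "Measurable.pred M (\<lambda>\<omega>. \<forall>k. p ^ k dvd f \<omega> \<longrightarrow> p ^ k dvd g \<omega>)"
    by measurable
  moreover have "(f \<omega> dvd g \<omega>) = (\<forall>k. p ^ k dvd f \<omega> \<longrightarrow> p ^ k dvd g \<omega>)" for \<omega>
    by (rule dvd_iff_powers)
  ultimately show ?thesis by simp
qed

lemma measurable_bareiss:
  assumes "i < d" "j < d" "k \<le> d"
  shows "(\<lambda>\<omega>. bareiss \<omega> k i j) \<in> measurable (matrix_measure d \<mu>) \<mu>"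
  using assms
proof (induction k arbitrary: i j)
  case 0
  then show ?case
    unfolding matrix_measure_def by (simp add: measurable_component_singleton)
next
  case (Suc k)
  then show ?case
    unfolding bareiss.simps by (intro measurable_haar_diff measurable_haar_mult Suc.IH) auto
qed

section \<open>Measure-preserving maps on the space of matrices\<close>

sublocale haar_product: product_prob_space "\<lambda>_. \<mu>"
proof -
  interpret prob_space \<mu> by (rule prob_space_haar)
  show "product_prob_space (\<lambda>_. \<mu>)" by unfold_locales
qed

text \<open>By Fubini the coordinate \<open>x\<close> is integrated first with all others frozen. As
  \<open>h\<close> ignores this coordinate, the map is then a translation, and Haar measure is
  translation invariant.\<close>

lemma preserving_shear:
  fixes I :: "'i set"
  assumes I: "finite I" "x \<in> I"
    and h: "h \<in> measurable (\<Pi>\<^sub>M i\<in>I. \<mu>) \<mu>" and indep: "\<And>\<xi> y. h (\<xi>(x := y)) = h \<xi>"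
  shows "preserving (\<Pi>\<^sub>M i\<in>I. \<mu>) (\<lambda>\<xi>. \<xi>(x := h \<xi> + \<xi> x))"
proof -
  let ?P = "\<Pi>\<^sub>M i\<in>I. \<mu>" and ?T = "\<lambda>\<xi>. \<xi>(x := h \<xi> + \<xi> x)"
  have comp: "(\<lambda>\<xi>. \<xi> i) \<in> measurable ?P \<mu>" if "i \<in> I" for i
    using that by (rule measurable_component_singleton)
  have T: "?T \<in> measurable ?P ?P"
  proof (rule measurable_PiM_single')
    show "(\<lambda>\<xi>. (\<xi>(x := h \<xi> + \<xi> x)) i) \<in> measurable ?P \<mu>" if "i \<in> I" for i
      using measurable_haar_add[OF h comp[OF I(2)]] comp[OF that] by (cases "i = x") auto
    show "?T \<in> space ?P \<rightarrow> (\<Pi>\<^sub>E i\<in>I. space \<mu>)"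
      using I by (auto simp: space_PiM PiE_def extensional_def)
  qed
  have "emeasure (distr ?P ?P ?T) B = emeasure ?P B" if B: "B \<in> sets ?P" for B
  proof -
    let ?J = "I - {x}"
    let ?Q = "PiM ?J (\<lambda>_. \<mu>)"
    have I_eq: "I = insert x ?J" using I by auto
    have insert: "integral\<^sup>N ?P f = (\<integral>\<^sup>+ \<xi>. (\<integral>\<^sup>+ y. f (\<xi>(x := y)) \<partial>\<mu>) \<partial>?Q)"
      if "f \<in> borel_measurable ?P" for f
      using haar_product.product_nn_integral_insert[of ?J x f] that I I_eq by simp
    have "emeasure (distr ?P ?P ?T) B = (\<integral>\<^sup>+ \<xi>. indicator B \<xi> \<partial>distr ?P ?P ?T)"
      using B by simp
    also have "\<dots> = (\<integral>\<^sup>+ \<xi>. indicator B (?T \<xi>) \<partial>?P)"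
      using borel_measurable_indicator[OF B] by (intro nn_integral_distr[OF T]) simp
    also have "\<dots> = (\<integral>\<^sup>+ \<xi>. (\<integral>\<^sup>+ y. indicator B (?T (\<xi>(x := y))) \<partial>\<mu>) \<partial>?Q)"
      using measurable_compose[OF T borel_measurable_indicator[OF B]] by (rule insert)
    also have "\<dots> = (\<integral>\<^sup>+ \<xi>. (\<integral>\<^sup>+ y. indicator B (\<xi>(x := h \<xi> + y)) \<partial>\<mu>) \<partial>?Q)"
      by (simp add: indep)
    also have "\<dots> = (\<integral>\<^sup>+ \<xi>. (\<integral>\<^sup>+ y. indicator B (\<xi>(x := y)) \<partial>\<mu>) \<partial>?Q)"
    proof (rule nn_integral_cong)
      fix \<xi> assume \<xi>: "\<xi> \<in> space ?Q"
      have upd: "(\<lambda>y. \<xi>(x := y)) \<in> measurable \<mu> ?P"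
        using measurable_fun_upd[where I=I and J="?J" and N=\<mu> and M="\<lambda>_. \<mu>" and f="\<lambda>_. \<xi>" and h="\<lambda>y. y" and i=x] I_eq \<xi> by auto
      have "(\<integral>\<^sup>+ y. indicator B (\<xi>(x := h \<xi> + y)) \<partial>\<mu>) =
          (\<integral>\<^sup>+ y. indicator B (\<xi>(x := y)) \<partial>distr \<mu> \<mu> (\<lambda>y. h \<xi> + y))"
        using measurable_compose[OF upd borel_measurable_indicator[OF B]]
        by (intro nn_integral_distr[symmetric]) (simp_all add: measurable_haar_add)
      then show "(\<integral>\<^sup>+ y. indicator B (\<xi>(x := h \<xi> + y)) \<partial>\<mu>) = (\<integral>\<^sup>+ y. indicator B (\<xi>(x := y)) \<partial>\<mu>)"
        by (simp add: distr_add_haar)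
    qed
    also have "\<dots> = (\<integral>\<^sup>+ \<xi>. indicator B \<xi> \<partial>?P)"
      using borel_measurable_indicator[OF B] by (rule insert[symmetric])
    finally show ?thesis using B by simp
  qed
  then have "distr ?P ?P ?T = ?P"
    by (intro measure_eqI) auto
  with T show ?thesis by (simp add: preserving_def)
qed

lemma preserving_add_row:
  assumes "i < d" "i' < d" "i \<noteq> i'"
  shows "preserving (matrix_measure d \<mu>) (add_row d i i' s)"
proof -
  \<comment> \<open>The row operation is a composition of shears, one per column; \<open>c\<close>
    counts the columns already treated.\<close>
  have "preserving (matrix_measure d \<mu>) (add_row c i i' s)" if "c \<le> d" for c
    using that
  proof (induction c)
    case 0
    have "add_row 0 i i' s = (\<lambda>\<xi>. \<xi>)" by (auto simp: add_row_def)
    then show ?case by (simp add: preserving_def distr_id)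
  next
    case (Suc c)
    have "preserving (matrix_measure d \<mu>) (\<lambda>\<xi>. \<xi>((i, c) := s * \<xi> (i', c) + \<xi> (i, c)))"
      unfolding matrix_measure_def
      by (rule preserving_shear) (use assms Suc.prems in \<open>auto intro!: measurable_haar_mult measurable_component_singleton\<close>)
    moreover have "preserving (matrix_measure d \<mu>) (add_row c i i' s)"
      using Suc by simp
    ultimately have "preserving (matrix_measure d \<mu>)
        (\<lambda>\<xi>. (add_row c i i' s \<xi>)((i, c) := s * add_row c i i' s \<xi> (i', c) + add_row c i i' s \<xi> (i, c)))"
      by (rule preserving_comp)
    also have "(\<lambda>\<xi>. (add_row c i i' s \<xi>)((i, c) := s * add_row c i i' s \<xi> (i', c) + add_row c i i' s \<xi> (i, c))) =
       add_row (Suc c) i i' s"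
      using assms by (auto simp: add_row_def fun_eq_iff algebra_simps)
    finally show ?case .
  qed
  then show ?thesis by simp
qed

lemma preserving_add_entry:
  assumes "i < d" "j < d"
  shows "preserving (matrix_measure d \<mu>) (\<lambda>\<xi>. \<xi>((i, j) := \<xi> (i, j) + s))"
  unfolding matrix_measure_def
  using preserving_shear[of "{..<d} \<times> {..<d}" "(i, j)" "\<lambda>_. s"] assms by (simp add: add.commute)

section \<open>Loss of precision in a column\<close>

abbreviation matrices :: "nat \<Rightarrow> (nat \<times> nat \<Rightarrow> 'r) measure" where
  "matrices d \<equiv> matrix_measure d \<mu>"

lemma prob_space_matrices: "prob_space (matrices d)"
  unfolding matrix_measure_def by (intro prob_space_PiM prob_space_haar)

text \<open>For each point at most one representative \<open>s\<close> modulo \<open>p ^ n\<close>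
  leads into \<open>B\<close>. So the \<open>q ^ n\<close> preimages of \<open>B\<close>, all of the
  same measure, are disjoint subsets of \<open>F\<close>.\<close>

lemma averaging_upper:
  assumes M: "prob_space M" and T: "\<And>s. preserving M (T s)" and B: "B \<in> sets M" and F: "F \<in> sets M"
    and inj: "\<And>\<xi> s t. \<xi> \<in> space M \<Longrightarrow> T s \<xi> \<in> B \<Longrightarrow> T t \<xi> \<in> B \<Longrightarrow> p ^ n dvd s - t"
    and sub: "\<And>\<xi> s. \<xi> \<in> space M \<Longrightarrow> T s \<xi> \<in> B \<Longrightarrow> \<xi> \<in> F"
  shows "real q ^ n * measure M B \<le> measure M F"
proof -
  interpret prob_space M by fact
  let ?A = "\<lambda>s. T s -` B \<inter> space M"
  have A: "measure M (?A s) = measure M B" "?A s \<in> sets M" for s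
    using measure_preserving_vimage[OF T B] by auto
  have "disjoint_family_on ?A (reps n)"
    unfolding disjoint_family_on_def
  proof (intro ballI impI)
    fix s t assume "s \<in> reps n" "t \<in> reps n" "s \<noteq> t"
    then have "\<not> p ^ n dvd s - t" using reps(3)[of n s] by fastforce
    then show "?A s \<inter> ?A t = {}" using inj by blast
  qed
  then have "real q ^ n * measure M B = measure M (\<Union>s\<in>reps n. ?A s)"
    using A by (subst finite_measure_finite_Union) (auto simp: reps)
  also have "\<dots> \<le> measure M F"
    using F sub by (intro finite_measure_mono) auto
  finally show ?thesis .
qed

text \<open>Counterpart of \<open>averaging_upper\<close>: here the \<open>q ^ n\<close> preimages
  of \<open>B\<close> cover \<open>C\<close>, and the union bound applies.\<close>

lemma averaging_lower:
  assumes M: "prob_space M" and T: "\<And>s. preserving M (T s)" and B: "B \<in> sets M" and C: "C \<in> sets M"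
    and ex: "\<And>\<xi>. \<xi> \<in> C \<Longrightarrow> \<exists>s\<in>reps n. T s \<xi> \<in> B"
  shows "measure M C \<le> real q ^ n * measure M B"
proof -
  interpret prob_space M by fact
  let ?A = "\<lambda>s. T s -` B \<inter> space M"
  have A: "measure M (?A s) = measure M B" "?A s \<in> sets M" for s
    using measure_preserving_vimage[OF T B] by auto
  have "measure M C \<le> measure M (\<Union>s\<in>reps n. ?A s)"
    using A ex sets.sets_into_space[OF C] by (intro finite_measure_mono sets.finite_UN) (auto simp: reps)
  also have "\<dots> \<le> (\<Sum>s\<in>reps n. measure M (?A s))"
    using A by (intro finite_measure_subadditive_finite) (auto simp: reps)
  also have "\<dots> = real q ^ n * measure M B"
    by (simp add: A reps)
  finally show ?thesis .
qed

lemma le_zero_of_power_bound: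
  assumes "\<And>n. real q ^ n * x \<le> 1"
  shows "x \<le> 0"
proof (rule ccontr)
  assume "\<not> x \<le> 0"
  obtain n where "1 / x < real q ^ n"
    using real_arch_pow[of "real q" "1 / x"] q_ge_2 by auto
  with assms[of n] \<open>\<not> x \<le> 0\<close> show False by (simp add: field_simps)
qed

lemma bareiss_column_measurable:
  assumes "i < d" "j < d"
  shows "(\<lambda>\<xi>. bareiss \<xi> j i j) \<in> measurable (matrices d) \<mu>"
  using assms by (intro measurable_bareiss) auto

lemma sets_bareiss_nonzero:
  assumes "i < d" "j < d"
  shows "{\<xi> \<in> space (matrices d). bareiss \<xi> j i j \<noteq> 0} \<in> sets (matrices d)"
proof -
  note [measurable] = bareiss_column_measurable
  \<comment> \<open>Divisibility by 0 means being 0, so measurability of \<open>dvd\<close>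
    applies.\<close>
  have "{\<xi> \<in> space (matrices d). \<not> 0 dvd bareiss \<xi> j i j} \<in> sets (matrices d)"
    using assms by measurable
  then show ?thesis by simp
qed

text \<open>When the earlier pivots are nonzero, the \<open>j\<close>-th is an affine function of
  the entry \<open>(j, j)\<close> with nonzero slope and has at most one root. Averaging over
  translations of this entry bounds the probability by \<open>1 / q ^ n\<close> for every
  \<open>n\<close>.\<close>

lemma AE_bareiss_nonzero:
  assumes "j < d"
  shows "AE \<xi> in matrices d. bareiss \<xi> j j j \<noteq> 0"
  using assms
proof (induction j rule: less_induct)
  case (less j)
  interpret prob_space "matrices d" by (rule prob_space_matrices)
  let ?B = "{\<xi> \<in> space (matrices d). bareiss \<xi> j j j = 0 \<and> (\<forall>t\<in>{..<j}. bareiss \<xi> t t t \<noteq> 0)}"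
  let ?N = "\<lambda>t. {\<xi> \<in> space (matrices d). bareiss \<xi> t t t \<noteq> 0}"
  have "?B = (space (matrices d) - ?N j) - (\<Union>t<j. space (matrices d) - ?N t)" by auto
  also have "\<dots> \<in> sets (matrices d)"
    using less.prems by (intro sets.Diff sets.finite_UN sets.top sets_bareiss_nonzero) auto
  finally have B: "?B \<in> sets (matrices d)" .
  have "real q ^ n * measure (matrices d) ?B \<le> measure (matrices d) (space (matrices d))" for n
  proof (rule averaging_upper[where T = "\<lambda>s \<xi>. \<xi>((j, j) := \<xi> (j, j) + s)"])
    fix \<xi> :: "nat \<times> nat \<Rightarrow> 'r" and s t
    have same: "bareiss (\<xi>((j, j) := \<xi> (j, j) + s)) t t t = bareiss \<xi> t t t" if "t < j" for s t
      using that by (intro bareiss_cong[where d = j]) auto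
    assume "\<xi>((j, j) := \<xi> (j, j) + s) \<in> ?B" "\<xi>((j, j) := \<xi> (j, j) + t) \<in> ?B"
    then have "bareiss \<xi> j j j + s * (\<Prod>t<j. bareiss \<xi> t t t) = 0"
      "bareiss \<xi> j j j + t * (\<Prod>t<j. bareiss \<xi> t t t) = 0"
      "\<forall>t<j. bareiss \<xi> t t t \<noteq> 0"
      using same by (auto simp: bareiss_update_diagonal)
    then have "s * (\<Prod>t<j. bareiss \<xi> t t t) = t * (\<Prod>t<j. bareiss \<xi> t t t)"
      "(\<Prod>t<j. bareiss \<xi> t t t) \<noteq> 0"
      by (metis add_left_cancel) (use \<open>\<forall>t<j. bareiss \<xi> t t t \<noteq> 0\<close> in auto)
    then show "p ^ n dvd s - t" by simp
  qed (use B less.prems preserving_add_entry prob_space_matrices in auto)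
  then have "measure (matrices d) ?B \<le> 0"
    by (intro le_zero_of_power_bound) (auto simp: prob_space)
  then have "measure (matrices d) ?B = 0"
    using measure_nonneg[of "matrices d" ?B] by linarith
  then have "AE \<xi> in matrices d. \<not> (bareiss \<xi> j j j = 0 \<and> (\<forall>t\<in>{..<j}. bareiss \<xi> t t t \<noteq> 0))"
    by (subst AE_iff_measurable[OF B]) (auto simp: emeasure_eq_measure)
  moreover have "AE \<xi> in matrices d. \<forall>t\<in>{..<j}. bareiss \<xi> t t t \<noteq> 0"
    using less by (intro AE_finite_allI) auto
  ultimately show ?case by eventually_elim auto
qed

text \<open>For a nonzero pivot: column \<open>j\<close> of \<open>L\<close> has an entry of
  valuation at most \<open>- n\<close> below the diagonal. The event is empty for
  \<open>j = d - 1\<close>.\<close>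

definition loss_event :: "nat \<Rightarrow> nat \<Rightarrow> nat \<Rightarrow> (nat \<times> nat \<Rightarrow> 'r) set" where
  "loss_event d n j = {\<xi> \<in> space (matrices d).
     \<exists>i\<in>{j<..<d}. p ^ n * bareiss \<xi> j i j dvd bareiss \<xi> j j j}"

text \<open>Among the entries below the pivot, one of smallest valuation decides the loss event.
  Taking the first such row makes these events disjoint, so their probabilities add up to at most
  1.\<close>

definition first_least :: "nat \<Rightarrow> nat \<Rightarrow> nat \<Rightarrow> (nat \<times> nat \<Rightarrow> 'r) set" where
  "first_least d j i = {\<xi> \<in> space (matrices d). \<forall>i'\<in>{j<..<d}.
     bareiss \<xi> j i j dvd bareiss \<xi> j i' j \<and> (i' < i \<longrightarrow> \<not> bareiss \<xi> j i' j dvd bareiss \<xi> j i j)}"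

lemma exists_first_least:
  assumes "j + 1 < d" "\<xi> \<in> space (matrices d)"
  shows "\<exists>i\<in>{j<..<d}. \<xi> \<in> first_least d j i"
proof -
  let ?P = "\<lambda>i. i \<in> {j<..<d} \<and> (\<forall>i'\<in>{j<..<d}. bareiss \<xi> j i j dvd bareiss \<xi> j i' j)"
  have "\<exists>i. ?P i"
    using exists_dvd_least[of "{j<..<d}" "\<lambda>i. bareiss \<xi> j i j"] assms(1) by fastforce
  then have P: "?P (LEAST i. ?P i)" by (rule LeastI_ex)
  moreover have "\<not> bareiss \<xi> j i' j dvd bareiss \<xi> j (LEAST i. ?P i) j"
    if i': "i' \<in> {j<..<d}" "i' < (LEAST i. ?P i)" for i'
  proof
    assume "bareiss \<xi> j i' j dvd bareiss \<xi> j (LEAST i. ?P i) j"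
    then have "?P i'" using i' P dvd_trans by blast
    then show False using not_less_Least[OF i'(2)] by blast
  qed
  ultimately show ?thesis
    using assms(2) unfolding first_least_def by (intro bexI[of _ "LEAST i. ?P i"]) auto
qed

lemma disjoint_first_least: "disjoint_family_on (first_least d j) {j<..<d}"
proof -
  have False if "\<xi> \<in> first_least d j i" "\<xi> \<in> first_least d j i'"
    "i \<in> {j<..<d}" "i' \<in> {j<..<d}" "i < i'" for \<xi> i i'
    using that by (auto simp: first_least_def)
  then show ?thesis
    unfolding disjoint_family_on_def by (metis disjoint_iff linorder_neqE_nat)
qed

lemma sets_first_least:
  assumes "i < d" "j < d"
  shows "first_least d j i \<in> sets (matrices d)"
proof -
  note [measurable] = bareiss_column_measurable
  show ?thesis
    unfolding first_least_def using assms by measurable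
qed

lemma pred_loss:
  assumes "i < d" "j < d"
  shows "{\<xi> \<in> space (matrices d). p ^ n * bareiss \<xi> j i j dvd bareiss \<xi> j j j} \<in> sets (matrices d)"
proof -
  note [measurable] = bareiss_column_measurable
  show ?thesis
    using assms by measurable
qed

lemma sets_loss_event:
  assumes "j < d"
  shows "loss_event d n j \<in> sets (matrices d)"
proof -
  note [measurable] = bareiss_column_measurable
  show ?thesis
    unfolding loss_event_def using assms by measurable
qed

lemma first_least_add_row:
  assumes "j < d" "i \<in> {j<..<d}" "\<xi> \<in> space (matrices d)"
  shows "add_row d j i s \<xi> \<in> first_least d j i \<longleftrightarrow> \<xi> \<in> first_least d j i"
  using assms preserving_in_space[OF preserving_add_row[of j d i s] assms(3)]
  by (auto simp: first_least_def bareiss_add_row)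

text \<open>Split according to the decisive row \<open>i\<close>. Adding \<open>s\<close> times row
  \<open>i\<close> to row \<open>j\<close> shifts the pivot by \<open>s\<close> times the decisive
  entry and keeps \<open>first_least\<close>. The shifts that land in the event agree modulo
  \<open>p ^ n\<close>, so each piece contributes at most \<open>1 / q ^ n\<close> of its
  probability.\<close>

lemma measure_loss_event_le:
  assumes j: "j < d"
  shows "real q ^ n * measure (matrices d) (loss_event d n j) \<le> 1"
proof -
  interpret prob_space "matrices d" by (rule prob_space_matrices)
  let ?I = "{j<..<d}" and ?F = "first_least d j"
  \<comment> \<open>The decisive entry must be nonzero in order to be cancelled below. This loses
    only a null set: in the loss event that entry divides the pivot, which is almost surely
    nonzero.\<close>
  define B where "B i = ?F i \<inter> {\<xi> \<in> space (matrices d). bareiss \<xi> j i j \<noteq> 0} \<inter>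
    {\<xi> \<in> space (matrices d). p ^ n * bareiss \<xi> j i j dvd bareiss \<xi> j j j}" for i
  have F: "?F i \<in> sets (matrices d)" if "i \<in> ?I" for i
    using that j by (intro sets_first_least) auto
  have B: "B i \<in> sets (matrices d)" if "i \<in> ?I" for i
    unfolding B_def using that j by (intro sets.Int F sets_bareiss_nonzero pred_loss) auto
  have le: "real q ^ n * measure (matrices d) (B i) \<le> measure (matrices d) (?F i)" if i: "i \<in> ?I" for i
  proof (rule averaging_upper[where T = "add_row d j i"])
    fix \<xi> s t assume \<xi>: "\<xi> \<in> space (matrices d)"
    assume "add_row d j i s \<xi> \<in> B i"
    then have s: "bareiss \<xi> j i j \<noteq> 0" "p ^ n * bareiss \<xi> j i j dvd bareiss \<xi> j j j + s * bareiss \<xi> j i j"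
      using i j by (auto simp: B_def bareiss_add_row)
    assume "add_row d j i t \<xi> \<in> B i"
    then have "p ^ n * bareiss \<xi> j i j dvd bareiss \<xi> j j j + t * bareiss \<xi> j i j"
      using i j by (auto simp: B_def bareiss_add_row)
    from dvd_diff[OF s(2) this] have "p ^ n * bareiss \<xi> j i j dvd (s - t) * bareiss \<xi> j i j"
      by (simp add: algebra_simps)
    with s(1) show "p ^ n dvd s - t" by simp
  next
    fix \<xi> s assume \<xi>: "\<xi> \<in> space (matrices d)" "add_row d j i s \<xi> \<in> B i"
    then show "\<xi> \<in> ?F i" using first_least_add_row[OF j i \<xi>(1)] by (auto simp: B_def)
  qed (use i j F B preserving_add_row prob_space_matrices in auto)
  have "measure (matrices d) (loss_event d n j) \<le> measure (matrices d) (\<Union>i\<in>?I. B i)"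
  proof (rule finite_measure_mono_AE)
    show "AE \<xi> in matrices d. \<xi> \<in> loss_event d n j \<longrightarrow> \<xi> \<in> (\<Union>i\<in>?I. B i)"
      using AE_bareiss_nonzero[OF j]
    proof (rule AE_mp, intro AE_I2 impI)
      fix \<xi> assume nz: "bareiss \<xi> j j j \<noteq> 0" and "\<xi> \<in> loss_event d n j"
      then obtain i where \<xi>: "\<xi> \<in> space (matrices d)" and i: "i \<in> ?I" 
        "p ^ n * bareiss \<xi> j i j dvd bareiss \<xi> j j j"
        by (auto simp: loss_event_def)
      obtain i0 where i0: "i0 \<in> ?I" "\<xi> \<in> ?F i0"
        using exists_first_least[of j d \<xi>] \<xi> i by fastforce
      then have "bareiss \<xi> j i0 j dvd bareiss \<xi> j i j"
        using i by (auto simp: first_least_def)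
      then have "p ^ n * bareiss \<xi> j i0 j dvd p ^ n * bareiss \<xi> j i j"
        by (rule mult_dvd_mono[OF dvd_refl])
      then have "p ^ n * bareiss \<xi> j i0 j dvd bareiss \<xi> j j j"
        using i(2) by (rule dvd_trans)
      with nz \<xi> i0 show "\<xi> \<in> (\<Union>i\<in>?I. B i)" by (auto simp: B_def)
    qed
  qed (use B in auto)
  also have "\<dots> \<le> (\<Sum>i\<in>?I. measure (matrices d) (B i))"
    using B by (intro finite_measure_subadditive_finite) auto
  finally have "real q ^ n * measure (matrices d) (loss_event d n j) \<le>
      real q ^ n * (\<Sum>i\<in>?I. measure (matrices d) (B i))"
    by (rule mult_left_mono) simp
  also have "\<dots> \<le> (\<Sum>i\<in>?I. measure (matrices d) (?F i))"
    unfolding sum_distrib_left by (rule sum_mono) (rule le)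
  also have "\<dots> = measure (matrices d) (\<Union>i\<in>?I. ?F i)"
    using F disjoint_first_least by (intro finite_measure_finite_Union[symmetric]) auto
  also have "\<dots> \<le> 1" by simp
  finally show ?thesis .
qed

text \<open>Applied with \<open>A\<close> the absence of loss in the columns before
  \<open>j\<close>. The factor 2 is the cost of having some entry below the pivot divide it;
  averaging over multiples of such an entry then costs the factor \<open>q ^ n\<close>.\<close>

lemma measure_le_loss_event:
  assumes j: "j + 1 < d" and A: "A \<in> sets (matrices d)"
    and inv: "\<And>\<xi> i i' s. \<xi> \<in> A \<Longrightarrow> i \<in> {j..<d} \<Longrightarrow> i' \<in> {j..<d} \<Longrightarrow> i \<noteq> i' \<Longrightarrow> add_row d i i' s \<xi> \<in> A"
  shows "measure (matrices d) A \<le> 2 * real q ^ n * measure (matrices d) (A \<inter> loss_event d n j)"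
proof -
  interpret prob_space "matrices d" by (rule prob_space_matrices)
  let ?I = "{j<..<d}" and ?F = "first_least d j"
  have F: "?F i \<in> sets (matrices d)" if "i \<in> ?I" for i
    using that j by (intro sets_first_least) auto
  have A_space: "\<xi> \<in> space (matrices d)" if "\<xi> \<in> A" for \<xi>
    using that sets.sets_into_space[OF A] by blast
  \<comment> \<open>Inside \<open>A\<close>, some entry below the pivot divides it: the loss event
    for exponent 0.\<close>
  define C where "C = A \<inter> loss_event d 0 j"
  have C: "C \<in> sets (matrices d)"
    unfolding C_def using A j by (intro sets.Int sets_loss_event) auto
  have half: "measure (matrices d) A \<le> 2 * measure (matrices d) C"
  proof -
    let ?T = "add_row d (j + 1) j 1"
    have T: "preserving (matrices d) ?T" using j by (intro preserving_add_row) auto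
    \<comment> \<open>If the pivot has strictly smallest valuation, adding its row to the next one produces an
      entry of the same valuation below it.\<close>
    have "?T \<xi> \<in> C" if \<xi>: "\<xi> \<in> A - C" for \<xi>
    proof -
      let ?b = "\<lambda>i. bareiss \<xi> j i j"
      have not: "\<not> ?b (j + 1) dvd ?b j"
        using \<xi> j A_space[of \<xi>] by (auto simp: C_def loss_event_def)
      have "\<not> ?b (j + 1) dvd ?b (j + 1) + ?b j"
        using not by (simp add: dvd_add_right_iff)
      then have "?b (j + 1) + ?b j dvd ?b (j + 1)"
        using dvd_total by blast
      then have "?b (j + 1) + ?b j dvd ?b j"
        using dvd_diff[OF dvd_refl] by (metis add_diff_cancel_left')
      then have "?T \<xi> \<in> loss_event d 0 j"
        using j \<xi> A_space preserving_in_space[OF T, of \<xi>]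
        by (auto simp: loss_event_def bareiss_add_row intro!: bexI[of _ "Suc j"])
      with \<xi> inv[of \<xi> "j + 1" j 1] j show ?thesis by (auto simp: C_def)
    qed
    then have "measure (matrices d) (A - C) \<le> measure (matrices d) (?T -` C \<inter> space (matrices d))"
      using measure_preserving_vimage[OF T C] A_space by (intro finite_measure_mono) auto
    also have "\<dots> = measure (matrices d) C" by (rule measure_preserving_vimage[OF T C])
    finally show ?thesis
      using finite_measure_Diff[OF A C] by (simp add: C_def)
  qed
  let ?B = "\<lambda>i. A \<inter> (?F i \<inter> {\<xi> \<in> space (matrices d). p ^ n * bareiss \<xi> j i j dvd bareiss \<xi> j j j})"
  have B: "?B i \<in> sets (matrices d)" if "i \<in> ?I" for i
    using that j by (intro sets.Int A F pred_loss) auto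
  have le: "measure (matrices d) (C \<inter> ?F i) \<le> real q ^ n * measure (matrices d) (?B i)" if i: "i \<in> ?I" for i
  proof (rule averaging_lower[where T = "add_row d j i"])
    fix \<xi> assume \<xi>: "\<xi> \<in> C \<inter> ?F i"
    let ?b = "\<lambda>i. bareiss \<xi> j i j"
    obtain i' where i': "i' \<in> ?I" "?b i' dvd ?b j" using \<xi> by (auto simp: C_def loss_event_def)
    then have "?b i dvd ?b j" using \<xi> by (auto simp: first_least_def intro: dvd_trans)
    then obtain c where c: "?b j = ?b i * c" by auto
    \<comment> \<open>The pivot is \<open>c\<close> times the decisive entry; adding
      \<open>s\<close> times that entry makes the cofactor \<open>c + s\<close>, so \<open>s\<close>
      is chosen congruent to \<open>- c\<close>.\<close>
    obtain s where s: "s \<in> reps n" "p ^ n dvd - c - s" using reps(3)[of n "- c"] by blast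
    then have "p ^ n dvd c + s" by (metis dvd_minus_iff minus_add_distrib uminus_add_conv_diff add.commute minus_diff_eq diff_conv_add_uminus)
    then have "p ^ n * ?b i dvd (c + s) * ?b i" by (rule mult_dvd_mono[OF _ dvd_refl])
    then have "p ^ n * ?b i dvd ?b j + s * ?b i" by (simp add: c algebra_simps)
    then have "add_row d j i s \<xi> \<in> ?B i"
      using \<xi> i j A_space preserving_in_space[OF preserving_add_row[of j d i s], of \<xi>] 
        first_least_add_row[of j d i \<xi> s] inv[of \<xi> j i s]
      by (auto simp: C_def bareiss_add_row)
    with s show "\<exists>s\<in>reps n. add_row d j i s \<xi> \<in> ?B i" by blast
  qed (use i j F B C preserving_add_row prob_space_matrices in auto)
  have "C \<subseteq> (\<Union>i\<in>?I. C \<inter> ?F i)"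
    using exists_first_least[OF j] A_space by (force simp: C_def)
  then have "measure (matrices d) C \<le> measure (matrices d) (\<Union>i\<in>?I. C \<inter> ?F i)"
    using C F by (intro finite_measure_mono sets.finite_UN) auto
  also have "\<dots> \<le> (\<Sum>i\<in>?I. measure (matrices d) (C \<inter> ?F i))"
    using C F by (intro finite_measure_subadditive_finite) auto
  also have "\<dots> \<le> (\<Sum>i\<in>?I. real q ^ n * measure (matrices d) (?B i))"
    by (rule sum_mono) (rule le)
  also have "\<dots> = real q ^ n * measure (matrices d) (\<Union>i\<in>?I. ?B i)"
  proof -
    have "disjoint_family_on ?B ?I"
      using disjoint_first_least[of d j] unfolding disjoint_family_on_def by blast
    then show ?thesis
      using B by (subst finite_measure_finite_Union) (auto simp: sum_distrib_left)
  qed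
  also have "\<dots> \<le> real q ^ n * measure (matrices d) (A \<inter> loss_event d n j)"
    using A j sets_loss_event by (intro mult_left_mono finite_measure_mono) (auto simp: loss_event_def)
  finally show ?thesis using half by simp
qed

text \<open>Both rows lie below the pivot row of the earlier column \<open>k\<close>, so the pivot
  is unchanged. By \<open>dvd_add_mult_cases\<close> the new entry can cause a loss only if one of
  the two old entries already did. Taking complements, \<open>no_loss\<close> is stable under such
  row operations.\<close>

lemma loss_event_add_row:
  assumes "\<xi> \<in> space (matrices d)" "k < j" "i \<in> {j..<d}" "i' \<in> {j..<d}" "i \<noteq> i'"
    and T: "add_row d i i' s \<xi> \<in> loss_event d n k"
  shows "\<xi> \<in> loss_event d n k"
proof -
  let ?b = "\<lambda>i. bareiss \<xi> k i k"
  from T assms obtain a where a: "a \<in> {k<..<d}" "p ^ n * (?b a + (if a = i then s * ?b i' else 0)) dvd ?b k"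
    by (auto simp: loss_event_def bareiss_add_row)
  have "\<exists>a\<in>{k<..<d}. p ^ n * ?b a dvd ?b k"
  proof (cases "a = i")
    case True
    then have "p ^ n * (?b i - (- s) * ?b i') dvd ?b k" using a by simp
    then have "p ^ n * ?b i dvd ?b k \<or> p ^ n * ?b i' dvd ?b k" by (rule dvd_add_mult_cases)
    then show ?thesis using assms by auto
  qed (use a in auto)
  then show ?thesis using assms(1) by (simp add: loss_event_def)
qed

definition no_loss :: "nat \<Rightarrow> nat \<Rightarrow> nat \<Rightarrow> (nat \<times> nat \<Rightarrow> 'r) set" where
  "no_loss d n j = space (matrices d) - (\<Union>k<j. loss_event d n k)"

text \<open>Each further column removes at least the fraction \<open>1 / (2 * real q ^ n)\<close> of
  what is left. The bound \<open>j < d\<close> ensures that every column involved has an entry below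
  its diagonal.\<close>

lemma measure_no_loss_le:
  assumes "j < d"
  shows "measure (matrices d) (no_loss d n j) \<le> (1 - 1 / (2 * real q ^ n)) ^ j"
  using assms
proof (induction j)
  case 0
  interpret prob_space "matrices d" by (rule prob_space_matrices)
  show ?case by simp
next
  case (Suc j)
  interpret prob_space "matrices d" by (rule prob_space_matrices)
  have q: "real q ^ n \<ge> 1" using q_ge_2 by (intro one_le_power) auto
  have sets: "no_loss d n j \<in> sets (matrices d)"
    unfolding no_loss_def using Suc.prems by (intro sets.Diff sets.finite_UN sets_loss_event) auto
  have "measure (matrices d) (no_loss d n j) \<le>
      2 * real q ^ n * measure (matrices d) (no_loss d n j \<inter> loss_event d n j)"
  proof (rule measure_le_loss_event[OF _ sets])
    fix \<xi> i i' s
    assume *: "\<xi> \<in> no_loss d n j" "i \<in> {j..<d}" "i' \<in> {j..<d}" "i \<noteq> i'"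
    then show "add_row d i i' s \<xi> \<in> no_loss d n j"
      using loss_event_add_row[of \<xi> d _ j i i' s n] preserving_in_space[OF preserving_add_row[of i d i' s], of \<xi>]
      unfolding no_loss_def by auto
  qed (use Suc.prems in auto)
  then have *: "measure (matrices d) (no_loss d n j \<inter> loss_event d n j) \<ge>
      measure (matrices d) (no_loss d n j) / (2 * real q ^ n)"
    using q q_ge_2 by (subst pos_divide_le_eq) (auto simp: mult_ac)
  have "no_loss d n (Suc j) = no_loss d n j - no_loss d n j \<inter> loss_event d n j"
    by (auto simp: no_loss_def less_Suc_eq)
  then have "measure (matrices d) (no_loss d n (Suc j)) = measure (matrices d) (no_loss d n j)
      - measure (matrices d) (no_loss d n j \<inter> loss_event d n j)"
    using sets Suc.prems sets_loss_event[of j d n] by (simp add: finite_measure_Diff)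
  also have "\<dots> \<le> measure (matrices d) (no_loss d n j) * (1 - 1 / (2 * real q ^ n))"
    using * by (simp add: algebra_simps)
  also have "\<dots> \<le> (1 - 1 / (2 * real q ^ n)) ^ j * (1 - 1 / (2 * real q ^ n))"
    using Suc q one_le_power[of "real q" n] by (intro mult_right_mono) (auto simp: divide_le_eq_1)
  finally show ?case by (simp add: mult.commute)
qed

end

section \<open>Tail bounds\<close>

text \<open>Take the inequality \<open>ln x \<le> x - 1\<close> at \<open>t / 2\<close> and add
  \<open>ln 2\<close>, which is at most 25/36 and so below 3/4.\<close>

lemma exp_quarter_minus_half_le:
  fixes t :: real
  assumes "t > 0"
  shows "exp (1 / 4 - t / 2) \<le> 1 / t"
proof -
  have "ln t = ln (t / 2) + ln 2" using assms by (simp add: ln_divide_pos)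
  also have "\<dots> \<le> t / 2 - 1 / 4"
    using ln_le_minus_one[of "t / 2"] ln2_le_25_over_36 assms by simp
  finally have "exp (1 / 4 - t / 2) \<le> exp (- ln t)" by simp
  also have "\<dots> = 1 / t" using assms by (simp add: exp_minus inverse_eq_divide)
  finally show ?thesis .
qed

section \<open>From column events to the distribution of \<open>V_L\<close>\<close>

context haar_dvr
begin

lemma map_mat_to_fract: "map_mat to_fract (mat d d \<xi>) = mat d d (\<lambda>x. to_fract (\<xi> x))"
  by (auto intro: eq_matI)

lemma L_defined_to_fract_iff:
  "L_defined (map_mat to_fract (mat d d \<xi>)) \<longleftrightarrow> (\<forall>j<d. bareiss \<xi> j j j \<noteq> 0)"
  by (simp add: map_mat_to_fract L_defined_iff flip: to_fract_bareiss)

text \<open>Entries of \<open>L\<close> above the diagonal vanish and diagonal ones have valuation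
  0, so for \<open>n \<ge> 1\<close> only the entries below the diagonal, those seen by
  \<open>loss_event\<close>, can reach valuation \<open>- n\<close>.\<close>

lemma V_L_ge_iff:
  assumes def: "L_defined (map_mat to_fract (mat d d \<xi>))"
    and sp: "\<xi> \<in> space (matrices d)" and n: "n \<ge> 1" and d: "d \<ge> 1"
  shows "int n \<le> V_L v (mat d d \<xi>) \<longleftrightarrow> (\<exists>j<d. \<xi> \<in> loss_event d n j)"
    and "0 \<le> V_L v (mat d d \<xi>)"
proof -
  have nz: "bareiss \<xi> j j j \<noteq> 0" if "j < d" for j
    using def that by (simp add: L_defined_to_fract_iff)
  let ?L = "mat d d (\<lambda>(i, j). to_fract (bareiss \<xi> j i j) / to_fract (bareiss \<xi> j j j))"
  have L: "L_part (map_mat to_fract (mat d d \<xi>)) = ?L"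
    unfolding map_mat_to_fract
    by (subst L_part_eq) (auto simp: nz simp flip: to_fract_bareiss)
  define X where "X = elements_mat ?L - {0}"
  have fin: "finite X" by (simp add: X_def elements_mat_def)
  have X_iff: "x \<in> X \<longleftrightarrow> (\<exists>i<d. \<exists>j<d. bareiss \<xi> j i j \<noteq> 0 \<and>
      x = to_fract (bareiss \<xi> j i j) / to_fract (bareiss \<xi> j j j))" for x
  proof
    assume "x \<in> X"
    then obtain i j where ij: "i < d" "j < d"
      "x = to_fract (bareiss \<xi> j i j) / to_fract (bareiss \<xi> j j j)" "x \<noteq> 0"
      by (auto simp: X_def dest!: elements_matD)
    then have "bareiss \<xi> j i j \<noteq> 0" by auto
    with ij show "\<exists>i<d. \<exists>j<d. bareiss \<xi> j i j \<noteq> 0 \<and>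
      x = to_fract (bareiss \<xi> j i j) / to_fract (bareiss \<xi> j j j)" by blast
  next
    assume "\<exists>i<d. \<exists>j<d. bareiss \<xi> j i j \<noteq> 0 \<and>
      x = to_fract (bareiss \<xi> j i j) / to_fract (bareiss \<xi> j j j)"
    then obtain i j where "i < d" "j < d" "bareiss \<xi> j i j \<noteq> 0"
      "x = to_fract (bareiss \<xi> j i j) / to_fract (bareiss \<xi> j j j)" by blast
    then show "x \<in> X" using elements_matI[of ?L d d i j x] by (simp add: X_def nz)
  qed
  \<comment> \<open>The entry \<open>(0, 0)\<close> of \<open>L\<close>, present because
    \<open>d \<ge> 1\<close>. It makes the minimum one over a nonempty set and gives
    \<open>V_L\<close> at least 0.\<close>
  have one: "1 \<in> X"
    using d nz[of 0] by (subst X_iff) (auto intro!: exI[of _ 0])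
  have V: "V_L v (mat d d \<xi>) = - Min (v ` X)"
    by (simp add: V_L_def L X_def)
  have ge: "m \<le> V_L v (mat d d \<xi>) \<longleftrightarrow> (\<exists>x\<in>X. m \<le> - v x)" for m
  proof -
    have "m \<le> V_L v (mat d d \<xi>) \<longleftrightarrow> Min (v ` X) \<le> - m" by (auto simp: V)
    also have "\<dots> \<longleftrightarrow> (\<exists>x\<in>X. v x \<le> - m)"
      using fin one by (subst Min_le_iff) auto
    finally show ?thesis by (simp add: le_minus_iff)
  qed
  show "0 \<le> V_L v (mat d d \<xi>)"
    using one v_one by (subst ge) (auto intro!: bexI[of _ 1])
  have dvd: "int n \<le> - v (to_fract (bareiss \<xi> j i j) / to_fract (bareiss \<xi> j j j)) \<longleftrightarrow>
      p ^ n * bareiss \<xi> j i j dvd bareiss \<xi> j j j"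
    if "j < d" "bareiss \<xi> j i j \<noteq> 0" for i j
  proof -
    have "v (to_fract (p ^ n * bareiss \<xi> j i j)) = int n + v (to_fract (bareiss \<xi> j i j))"
      unfolding to_fract_mult using that v_power_p[of n] by (subst v_mult) auto
    then show ?thesis
      using that nz[of j] by (auto simp: v_div dvd_iff_v simp del: to_fract_mult)
  qed
  have "i \<in> {j<..<d} \<and> bareiss \<xi> j i j \<noteq> 0"
    if "i < d" "j < d" "p ^ n * bareiss \<xi> j i j dvd bareiss \<xi> j j j" for i j
  proof -
    have "bareiss \<xi> j i j \<noteq> 0" using that nz[of j] by auto
    moreover have "i \<noteq> j"
    proof
      assume "i = j"
      then have "p ^ n * bareiss \<xi> j j j dvd 1 * bareiss \<xi> j j j" using that by simp
      then have "p ^ n dvd 1"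
        using nz[OF that(2)] by (simp only: dvd_mult_cancel_right) simp
      then show False using n power_dvd_iff[of n 1] by (simp add: v_one)
    qed
    ultimately show ?thesis using that bareiss_eq_0[of i j j \<xi>] by fastforce
  qed
  note below = this
  show "int n \<le> V_L v (mat d d \<xi>) \<longleftrightarrow> (\<exists>j<d. \<xi> \<in> loss_event d n j)"
  proof
    assume "int n \<le> V_L v (mat d d \<xi>)"
    then obtain i j where ij: "i < d" "j < d" "p ^ n * bareiss \<xi> j i j dvd bareiss \<xi> j j j"
      unfolding ge using dvd by (auto simp: X_iff)
    then show "\<exists>j<d. \<xi> \<in> loss_event d n j"
      using below[OF ij] sp unfolding loss_event_def by blast
  next
    assume "\<exists>j<d. \<xi> \<in> loss_event d n j"
    then obtain i j where "j < d" "i \<in> {j<..<d}" "p ^ n * bareiss \<xi> j i j dvd bareiss \<xi> j j j"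
      unfolding loss_event_def by blast
    then have ij: "i < d" "j < d" "p ^ n * bareiss \<xi> j i j dvd bareiss \<xi> j j j"
      by auto
    then have "bareiss \<xi> j i j \<noteq> 0" using below by blast
    with ij show "int n \<le> V_L v (mat d d \<xi>)"
      unfolding ge using dvd by (intro bexI[of _ "to_fract (bareiss \<xi> j i j) / to_fract (bareiss \<xi> j j j)"])
        (auto simp: X_iff)
  qed
qed

lemma AE_L_defined: "AE \<xi> in matrices d. L_defined (map_mat to_fract (mat d d \<xi>))"
proof -
  have "AE \<xi> in matrices d. \<forall>j\<in>{..<d}. bareiss \<xi> j j j \<noteq> 0"
    using AE_bareiss_nonzero by (intro AE_finite_allI) auto
  then show ?thesis by eventually_elim (simp add: L_defined_to_fract_iff)
qed

text \<open>\<open>V_L\<close> takes values in the natural numbers, so any event about it is a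
  countable union of differences of consecutive events \<open>?G\<close>, which the column events
  describe.\<close>

lemma sets_V_L:
  assumes "d \<ge> 1"
  shows "{\<xi> \<in> space (matrices d). L_defined (map_mat to_fract (mat d d \<xi>)) \<and> P (V_L v (mat d d \<xi>))}
    \<in> sets (matrices d)" (is "?E \<in> _")
proof -
  let ?D = "{\<xi> \<in> space (matrices d). L_defined (map_mat to_fract (mat d d \<xi>))}"
  let ?G = "\<lambda>n. {\<xi> \<in> ?D. int n \<le> V_L v (mat d d \<xi>)}"
  have "?D = space (matrices d) \<inter> (\<Inter>j\<in>{..<d}. {\<xi> \<in> space (matrices d). bareiss \<xi> j j j \<noteq> 0})"
    using assms by (auto simp: L_defined_to_fract_iff)
  also have "\<dots> \<in> sets (matrices d)"
    using assms by (intro sets.Int sets.top sets.finite_INT sets_bareiss_nonzero)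
      (auto simp: lessThan_empty_iff)
  finally have D: "?D \<in> sets (matrices d)" .
  have G: "?G n \<in> sets (matrices d)" for n
  proof (cases "n = 0")
    case True
    then have "?G n = ?D" using V_L_ge_iff(2)[of d _ 1] assms by auto
    with D show ?thesis by simp
  next
    case False
    then have "?G n = ?D \<inter> (\<Union>j<d. loss_event d n j)"
      using V_L_ge_iff(1)[of d _ n] assms by auto
    also have "\<dots> \<in> sets (matrices d)"
      using D by (intro sets.Int sets.finite_UN sets_loss_event) auto
    finally show ?thesis .
  qed
  have "?E = (\<Union>n\<in>{n. P (int n)}. ?G n - ?G (Suc n))"
  proof (intro equalityI subsetI)
    fix \<xi> assume \<xi>: "\<xi> \<in> ?E"
    then have "V_L v (mat d d \<xi>) = int (nat (V_L v (mat d d \<xi>)))"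
      using V_L_ge_iff(2)[of d \<xi> 1] assms by auto
    then show "\<xi> \<in> (\<Union>n\<in>{n. P (int n)}. ?G n - ?G (Suc n))"
      using \<xi> by (intro UN_I[of "nat (V_L v (mat d d \<xi>))"]) auto
  next
    fix \<xi> assume "\<xi> \<in> (\<Union>n\<in>{n. P (int n)}. ?G n - ?G (Suc n))"
    then obtain n where "P (int n)" "\<xi> \<in> ?D" "int n \<le> V_L v (mat d d \<xi>)" "\<not> int (Suc n) \<le> V_L v (mat d d \<xi>)"
      by auto
    moreover from this have "V_L v (mat d d \<xi>) = int n" by linarith
    ultimately show "\<xi> \<in> ?E" by auto
  qed
  also have "\<dots> \<in> sets (matrices d)"
    by (intro sets.countable_UN'' sets.Diff G) simp
  finally show ?thesis .
qed

lemma measure_V_L_ge: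
  assumes "d \<ge> 1" "n \<ge> 1"
  shows "measure (matrices d) {\<xi> \<in> space (matrices d). L_defined (map_mat to_fract (mat d d \<xi>)) \<and>
      int n \<le> V_L v (mat d d \<xi>)} \<le> real d / real q ^ n" (is "measure _ ?E \<le> _")
proof -
  interpret prob_space "matrices d" by (rule prob_space_matrices)
  have "measure (matrices d) ?E \<le> measure (matrices d) (\<Union>j<d. loss_event d n j)"
    using V_L_ge_iff(1)[of d _ n] assms sets_loss_event
    by (intro finite_measure_mono sets.finite_UN) auto
  also have "\<dots> \<le> (\<Sum>j<d. measure (matrices d) (loss_event d n j))"
    using sets_loss_event by (intro finite_measure_subadditive_finite) auto
  also have "\<dots> \<le> (\<Sum>j<d. 1 / real q ^ n)"
    using measure_loss_event_le q_ge_2 by (intro sum_mono) (simp add: field_simps)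
  finally show ?thesis by simp
qed

text \<open>The exponent is \<open>d - 1\<close> because the last column of \<open>L\<close> has
  nothing below its diagonal.\<close>

lemma measure_V_L_less:
  assumes "d \<ge> 1" "n \<ge> 1"
  shows "measure (matrices d) {\<xi> \<in> space (matrices d). L_defined (map_mat to_fract (mat d d \<xi>)) \<and>
      V_L v (mat d d \<xi>) < int n} \<le> (1 - 1 / (2 * real q ^ n)) ^ (d - 1)" (is "measure _ ?E \<le> _")
proof -
  interpret prob_space "matrices d" by (rule prob_space_matrices)
  have "?E \<subseteq> no_loss d n (d - 1)"
    using V_L_ge_iff(1)[of d _ n] assms by (fastforce simp: no_loss_def)
  moreover have "no_loss d n (d - 1) \<in> sets (matrices d)"
    unfolding no_loss_def by (intro sets.Diff sets.finite_UN sets_loss_event) auto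
  ultimately have "measure (matrices d) ?E \<le> measure (matrices d) (no_loss d n (d - 1))"
    by (intro finite_measure_mono)
  also have "\<dots> \<le> (1 - 1 / (2 * real q ^ n)) ^ (d - 1)"
    using assms by (intro measure_no_loss_le) auto
  finally show ?thesis .
qed

lemma measure_V_L_deviation:
  assumes d: "d \<ge> 1" and l: "l > 0"
  shows "measure (matrices d) {\<xi> \<in> space (matrices d). L_defined (map_mat to_fract (mat d d \<xi>)) \<and>
      \<bar>real_of_int (V_L v (mat d d \<xi>)) - log (real q) (real d) + 1 / 2\<bar> > l + 1 / 2}
    \<le> 2 * real q powr (- l)" (is "measure _ ?E \<le> _")
proof -
  interpret prob_space "matrices d" by (rule prob_space_matrices)
  let ?V = "\<lambda>\<xi>. V_L v (mat d d \<xi>)" and ?x = "log (real q) (real d)" and ?t = "real q powr l"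
  let ?D = "\<lambda>\<xi>. \<xi> \<in> space (matrices d) \<and> L_defined (map_mat to_fract (mat d d \<xi>))"
  have q: "real q \<ge> 2" using q_ge_2 by simp
  have x: "?x \<ge> 0" using q d by simp
  have qx: "real q powr ?x = real d" using q d by simp
  have t: "?t > 1" using q l by simp
  \<comment> \<open>The centre \<open>?x - 1 / 2\<close> and radius \<open>l + 1 / 2\<close> give
    the thresholds \<open>?x + l\<close> and \<open>?x - l - 1\<close>. The least integer above the
    first is \<open>n\<close>, so \<open>d / q ^ n\<close> is at most
    \<open>q powr (- l)\<close>.\<close>
  define n where "n = nat \<lfloor>?x + l\<rfloor> + 1"
  define U where "U = {\<xi> \<in> space (matrices d). L_defined (map_mat to_fract (mat d d \<xi>)) \<and> int n \<le> ?V \<xi>}"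
  define W where "W = {\<xi> \<in> space (matrices d). L_defined (map_mat to_fract (mat d d \<xi>)) \<and>
     real_of_int (?V \<xi>) < ?x - l - 1}"
  have sets: "U \<in> sets (matrices d)" "W \<in> sets (matrices d)"
    unfolding U_def W_def using sets_V_L[OF d, of "\<lambda>m. int n \<le> m"]
      sets_V_L[OF d, of "\<lambda>m. real_of_int m < ?x - l - 1"] by auto
  have "?E \<subseteq> U \<union> W"
  proof
    fix \<xi> assume \<xi>: "\<xi> \<in> ?E"
    then consider "real_of_int (?V \<xi>) > ?x + l" | "real_of_int (?V \<xi>) < ?x - l - 1" by (auto simp: abs_if split: if_splits)
    then show "\<xi> \<in> U \<union> W"
    proof cases
      case 1
      then have "int n \<le> ?V \<xi>" using x l unfolding n_def by linarith
      with \<xi> show ?thesis by (auto simp: U_def)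
    qed (use \<xi> in \<open>auto simp: W_def\<close>)
  qed
  then have "measure (matrices d) ?E \<le> measure (matrices d) (U \<union> W)"
    using sets by (intro finite_measure_mono) auto
  also have "\<dots> \<le> measure (matrices d) U + measure (matrices d) W"
    using sets measure_Un_le by blast
  also have "measure (matrices d) U \<le> 1 / ?t"
  proof -
    have "real d * ?t = real q powr (?x + l)" using qx by (simp add: powr_add)
    also have "\<dots> \<le> real q powr real n"
      using q x l unfolding n_def by (intro powr_mono) linarith+
    also have "\<dots> = real q ^ n" using q by (simp add: powr_realpow)
    finally have "real d / real q ^ n \<le> 1 / ?t" using q t by (simp add: field_simps)
    then show ?thesis using measure_V_L_ge[OF d, of n] unfolding U_def by (simp add: n_def)
  qed
  also have "measure (matrices d) W \<le> 1 / ?t"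
  proof (cases "?x - l - 1 \<le> 0")
    case True
    \<comment> \<open>A negative value of \<open>V_L\<close> would be required.\<close>
    then have "W = {}" using V_L_ge_iff(2)[of d _ 1] d by (force simp: W_def)
    then show ?thesis using t by simp
  next
    case False
    \<comment> \<open>Rounding up costs less than 1, which the extra unit in the lower threshold
      absorbs: \<open>m\<close> is still at most \<open>?x - l\<close>, so \<open>d / q ^ m\<close>
      is at least \<open>?t\<close>.\<close>
    define m where "m = nat \<lceil>?x - l - 1\<rceil>"
    have m: "m \<ge> 1" "real m \<le> ?x - l" "?x - l - 1 \<le> real m" using False unfolding m_def by linarith+
    define y where "y = 1 / (2 * real q ^ m)"
    have qm: "real q ^ m \<ge> 2" using m(1) q self_le_power[of "real q" m] by linarith
    have "measure (matrices d) W \<le> (1 - y) ^ (d - 1)"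
    proof -
      have "W \<subseteq> {\<xi> \<in> space (matrices d). L_defined (map_mat to_fract (mat d d \<xi>)) \<and> ?V \<xi> < int m}"
        using m(3) by (force simp: W_def)
      then have "measure (matrices d) W \<le> measure (matrices d) \<dots>"
        using sets_V_L[OF d, of "\<lambda>i. i < int m"] by (intro finite_measure_mono)
      with measure_V_L_less[OF d m(1)] show ?thesis unfolding y_def by linarith
    qed
    also have "\<dots> \<le> exp (- y) ^ (d - 1)"
      using qm exp_ge_add_one_self[of "- y"] by (intro power_mono) (auto simp: y_def divide_le_eq_1)
    also have "\<dots> = exp (- (y * (real d - 1)))"
      using d by (simp add: of_nat_diff flip: exp_of_nat_mult)
    also have "\<dots> \<le> exp (1 / 4 - ?t / 2)"
    proof -
      have "real q ^ m * ?t = real q powr (real m + l)" using q by (simp add: powr_add powr_realpow)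
      also have "\<dots> \<le> real q powr ?x" using q m(2) by (intro powr_mono) auto
      finally have "?t \<le> real d / real q ^ m"
        using qm unfolding qx by (subst pos_le_divide_eq) (linarith, simp add: mult.commute)
      then have "?t / 2 \<le> y * real d" by (simp add: y_def)
      \<comment> \<open>Since \<open>q ^ m \<ge> 2\<close>. This pays for having
        \<open>d - 1\<close> instead of \<open>d\<close> in the exponent and is the source of the
        constant 1/4.\<close>
      moreover have "y \<le> 1 / 4" using qm by (simp add: y_def divide_le_eq)
      ultimately show ?thesis by (simp add: algebra_simps)
    qed
    also have "\<dots> \<le> 1 / ?t"
      using t by (intro exp_quarter_minus_half_le) linarith
    finally show ?thesis .
  qed
  finally show ?thesis by (simp add: powr_minus field_simps)
qed

end

theorem theorem1p2:
  fixes v :: "'r::idom fract \<Rightarrow> int" and \<mu> :: "'r measure" and q d :: nat and l :: real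
  assumes R: "complete_dvr v"
    and residue: "finite (residue_field :: 'r set set)" "card (residue_field :: 'r set set) = q"
    and haar: "haar_prob (Metric_space.mtopology UNIV (discrete_valuation_ring.val_dist v)) \<mu>"
    and d: "d \<ge> 1"
    and l: "l > 0"
  defines "\<Omega> \<equiv> matrix_measure d \<mu>"
  defines "E \<equiv> {\<omega> \<in> space \<Omega>. L_defined (map_mat to_fract (mat d d \<omega>)) \<and>
                 \<bar>real_of_int (V_L v (mat d d \<omega>)) - log (real q) (real d) + 1 / 2\<bar> > l + 1 / 2}"
  shows "(AE \<omega> in \<Omega>. L_defined (map_mat to_fract (mat d d \<omega>))) \<and>
         E \<in> sets \<Omega> \<and>
         measure \<Omega> E \<le> real q / (real q - 1) * real q powr (- l) * (2 + l * ln (real q))"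
proof -
  interpret complete_dvr v by (rule R)
  obtain \<pi> where "\<pi> \<noteq> 0" "v \<pi> = 1" using v_normalized by blast
  \<comment> \<open>An element of valuation 1 lies in the valuation ring, so the uniformizer comes
    from R.\<close>
  then obtain p :: 'r where p: "to_fract p = \<pi>"
    using valuation_ring by (metis (mono_tags, lifting) imageE mem_Collect_eq zero_le_one)
  interpret haar_dvr v p q \<mu>
    using p \<open>\<pi> \<noteq> 0\<close> \<open>v \<pi> = 1\<close> residue haar by unfold_locales auto
  have q: "real q \<ge> 2" using q_ge_2 by simp
  have "measure \<Omega> E \<le> 2 * real q powr (- l)"
    unfolding \<Omega>_def E_def using d l by (rule measure_V_L_deviation)
  \<comment> \<open>The bound \<open>2 * real q powr (- l)\<close> is already stronger than the
    claim: \<open>l * ln (real q)\<close> is nonnegative and \<open>real q / (real q - 1)\<close> is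
    at least 1.\<close>
  also have "\<dots> \<le> (2 + l * ln (real q)) * real q powr (- l)"
    using q l by (intro mult_right_mono) auto
  also have "\<dots> \<le> real q / (real q - 1) * ((2 + l * ln (real q)) * real q powr (- l))"
  proof -
    have "0 \<le> (2 + l * ln (real q)) * real q powr (- l)" "1 \<le> real q / (real q - 1)"
      using q l by (auto intro!: mult_nonneg_nonneg add_nonneg_nonneg simp: field_simps)
    then show ?thesis using mult_right_mono by fastforce
  qed
  finally have "measure \<Omega> E \<le> real q / (real q - 1) * real q powr (- l) * (2 + l * ln (real q))"
    by (simp add: mult_ac)
  moreover have "E \<in> sets \<Omega>"
    unfolding \<Omega>_def E_def using d
    by (rule sets_V_L[of d "\<lambda>m. \<bar>real_of_int m - log (real q) (real d) + 1 / 2\<bar> > l + 1 / 2"])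
  moreover have "AE \<omega> in \<Omega>. L_defined (map_mat to_fract (mat d d \<omega>))"
    unfolding \<Omega>_def by (rule AE_L_defined)
  ultimately show ?thesis by blast
qed

end
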